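(* Let $H$ be a strictly $2$-balanced graph with $1 < m_2(H) < \frac{\delta(H)(\delta(H)+1)}{2\delta(H)+1}$. Then there exists a constant $c > 0$ such that if $p = p(n) \le c\, n^{-1/m_2(H)}$ then $\lim_{n\to\infty} \mathbb{P}\big[G(n,p) \xrightarrow{\mathrm{a-ram}} H\big] = 0$.
   Context: $\delta(H)$ is the minimum degree of $H$. $G(n,p)$ is the random graph on $n$ vertices with each edge present independently with probability $p$. $G \xrightarrow{\mathrm{a-ram}} H$ means every proper edge-colouring of $G$ contains a rainbow copy of $H$ (a subgraph isomorphic to $H$ with pairwise distinct edge colours). For a graph $J$, $d_2(J) = \frac{e(J)-1}{v(J)-2}$ if $e(J)\ge 1$ and $v(J)\ge 3$, $d_2(K_2) = 1/2$, and $d_2(J)=0$ otherwise; $m_2(H) = \max\{d_2(J) : J \subseteq H\}$. $H$ is strictly $2$-balanced if $d_2(J) < d_2(H)$ for every proper subgraph $J \subsetneq H$. *)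

theory Defs
  imports "HOL-Probability.Probability" "HOL-Library.Ramsey"
begin

datatype (dead 'a) ugraph = Ugraph (verts: "'a set") (edges: "'a set set")

definition simple_graph :: "'a ugraph \<Rightarrow> bool" where
  "simple_graph G \<longleftrightarrow> finite (verts G) \<and> edges G \<subseteq> nsets (verts G) 2"

definition subgraph_of :: "'a ugraph \<Rightarrow> 'a ugraph \<Rightarrow> bool" where
  "subgraph_of J H \<longleftrightarrow> simple_graph J \<and> verts J \<subseteq> verts H \<and> edges J \<subseteq> edges H"

definition degree_of :: "'a ugraph \<Rightarrow> 'a \<Rightarrow> nat" where
  "degree_of G v = card {e \<in> edges G. v \<in> e}"

text \<open>Unspecified for the graph without vertices.\<close>

definition min_degree :: "'a ugraph \<Rightarrow> nat" where
  "min_degree G = Min (degree_of G ` verts G)"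

definition isomorphic :: "'a ugraph \<Rightarrow> 'b ugraph \<Rightarrow> bool" where
  "isomorphic G H \<longleftrightarrow>
     (\<exists>f. bij_betw f (verts G) (verts H) \<and>
          (\<forall>u\<in>verts G. \<forall>v\<in>verts G. {u, v} \<in> edges G \<longleftrightarrow> {f u, f v} \<in> edges H))"

text \<open>For a simple graph on two vertices, having at least one edge means being \<open>K\<^sub>2\<close>.\<close>

definition d2 :: "'a ugraph \<Rightarrow> real" where
  "d2 J =
     (if card (edges J) \<ge> 1 \<and> card (verts J) \<ge> 3
        then (real (card (edges J)) - 1) / (real (card (verts J)) - 2)
      else if card (edges J) = 1 \<and> card (verts J) = 2 then 1 / 2
      else 0)"

definition m2 :: "'a ugraph \<Rightarrow> real" where
  "m2 H = Max {d2 J |J. subgraph_of J H}"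

definition strictly_2_balanced :: "'a ugraph \<Rightarrow> bool" where
  "strictly_2_balanced H \<longleftrightarrow> (\<forall>J. subgraph_of J H \<and> J \<noteq> H \<longrightarrow> d2 J < d2 H)"

definition proper_edge_colouring :: "'a ugraph \<Rightarrow> ('a set \<Rightarrow> 'c) \<Rightarrow> bool" where
  "proper_edge_colouring G col \<longleftrightarrow>
     (\<forall>e\<in>edges G. \<forall>e'\<in>edges G. e \<noteq> e' \<and> e \<inter> e' \<noteq> {} \<longrightarrow> col e \<noteq> col e')"

text \<open>Natural numbers as colours lose no generality, since the graphs considered are finite.\<close>

definition anti_ramsey :: "'a ugraph \<Rightarrow> 'b ugraph \<Rightarrow> bool" where
  "anti_ramsey G H \<longleftrightarrow>
     (\<forall>col :: 'a set \<Rightarrow> nat. proper_edge_colouring G col \<longrightarrow>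
        (\<exists>J. subgraph_of J G \<and> isomorphic J H \<and> inj_on col (edges J)))"

definition random_graph :: "nat \<Rightarrow> real \<Rightarrow> nat ugraph pmf" where
  "random_graph n p =
     map_pmf (\<lambda>X. Ugraph {..<n} {e \<in> nsets {..<n} 2. X e})
       (Pi_pmf (nsets {..<n} 2) False (\<lambda>_. bernoulli_pmf p))"

end

theory Submission
  imports Defs "HOL-Real_Asymp.Real_Asymp"
begin

text \<open>Write \<open>\<delta>\<close> for the minimum degree of \<open>H\<close> and \<open>M = \<delta>(\<delta> + 1) / (2\<delta> + 1)\<close>. In a minimal graph \<open>X\<close>
  that is anti-Ramsey for \<open>H\<close>, grow a union \<open>F\<close> of copies of \<open>H\<close>: while some vertex has \<open>F\<close>-degree
  only \<open>\<delta>\<close> and a further copy in \<open>X\<close> uses both an old and a new edge there, add that copy. If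
  the process stops, no two vertices of degree \<open>\<delta>\<close> are adjacent in \<open>F\<close>, since otherwise \<open>X\<close> could be
  recoloured; double counting then gives \<open>e(F) \<ge> M v(F)\<close>. As \<open>M > m\<^sub>2(H)\<close>, with high
  probability the random graph has no such \<open>F\<close> with at most \<open>\<lceil>ln n\<rceil>\<close> vertices.

  If the process runs for \<open>\<lceil>ln n\<rceil>\<close> steps, a first-moment bound applies. Adding a copy along a single
  edge at the current vertex has expected multiplicity at most a constant times \<open>c\<close>, because
  \<open>m\<^sub>2(H) = (e(H) - 1) / (v(H) - 2)\<close>; every larger overlap costs a negative power of \<open>n\<close>, because
  \<open>H\<close> is strictly 2-balanced. Thus the exploration is subcritical for small \<open>c\<close>.\<close>

subsection \<open>Copies as embeddings\<close>

text \<open>Colourings and containment in the random graph see only edges, so a copy is recorded by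
  its edge set; its non-isolated vertices are recovered as
  \<open>\<Union>(copy H g)\<close>.\<close>

definition copy :: "'a ugraph \<Rightarrow> ('a \<Rightarrow> nat) \<Rightarrow> nat set set" where
  "copy H g = (\<lambda>e. g ` e) ` edges H"

text \<open>Extensional functions make this a finite set of at most
  \<open>n ^ card (verts H)\<close> elements, fit to index sums and union bounds.\<close>

definition embs :: "'a ugraph \<Rightarrow> nat \<Rightarrow> ('a \<Rightarrow> nat) set" where
  "embs H n = {g \<in> verts H \<rightarrow>\<^sub>E {..<n}. inj_on g (verts H)}"

definition edges_at :: "'a set set \<Rightarrow> 'a \<Rightarrow> 'a set set" where
  "edges_at F v = {e \<in> F. v \<in> e}"

lemma simple_graph_edge_subset: "simple_graph H \<Longrightarrow> e \<in> edges H \<Longrightarrow> e \<subseteq> verts H"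
  by (auto simp: simple_graph_def nsets_def)

lemma simple_graph_edge_card: "simple_graph H \<Longrightarrow> e \<in> edges H \<Longrightarrow> card e = 2"
  by (auto simp: simple_graph_def nsets_def)

lemma simple_graph_finite: "simple_graph H \<Longrightarrow> finite (verts H) \<and> finite (edges H)"
  by (meson finite_imp_finite_nsets finite_subset simple_graph_def)

lemma in_embsD: "g \<in> embs H n \<Longrightarrow> inj_on g (verts H)" "g \<in> embs H n \<Longrightarrow> g ` verts H \<subseteq> {..<n}"
  by (auto simp: embs_def)

lemma finite_embs: "simple_graph H \<Longrightarrow> finite (embs H n)"
  unfolding embs_def by (rule finite_subset[of _ "verts H \<rightarrow>\<^sub>E {..<n}"])
    (auto intro: finite_PiE simp: simple_graph_finite)

lemma inj_on_image_edges:
  assumes "simple_graph H" "inj_on g (verts H)"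
  shows "inj_on (\<lambda>e. g ` e) (edges H)"
proof (rule inj_onI)
  fix e e' assume "e \<in> edges H" "e' \<in> edges H" "g ` e = g ` e'"
  with assms show "e = e'"
    by (metis inj_on_image_eq_iff simple_graph_edge_subset)
qed

lemma finite_copy: "simple_graph H \<Longrightarrow> finite (copy H g)"
  by (simp add: copy_def simple_graph_finite)

lemma copy_nsets:
  assumes "simple_graph H" "g \<in> embs H n"
  shows "copy H g \<subseteq> nsets {..<n} 2"
proof
  fix f assume "f \<in> copy H g"
  then obtain e where e: "e \<in> edges H" "f = g ` e" by (auto simp: copy_def)
  have es: "e \<subseteq> verts H" "card e = 2" using assms e
    by (auto simp: simple_graph_edge_subset simple_graph_edge_card)
  have "inj_on g e" using es in_embsD[OF assms(2)] by (meson inj_on_subset)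
  then have "card f = 2" using es e by (simp add: card_image)
  moreover have "f \<subseteq> {..<n}" using e es in_embsD[OF assms(2)] by auto
  moreover have "finite f" using \<open>card f = 2\<close> by (metis card.infinite zero_neq_numeral)
  ultimately show "f \<in> nsets {..<n} 2" by (simp add: nsets_def)
qed

lemma edge_pair:
  assumes "simple_graph H" "e \<in> edges H" "x \<in> e"
  obtains y where "e = {x, y}" "y \<noteq> x" "y \<in> verts H"
proof -
  have "card e = 2" using assms simple_graph_edge_card by blast
  then obtain y where "e = {x, y}" "y \<noteq> x" using assms(3)
    by (metis card_2_iff doubleton_eq_iff insertE singletonD)
  then show ?thesis using that simple_graph_edge_subset[OF assms(1,2)] by blast
qed

lemma isomorphic_imp_copy:
  assumes H: "simple_graph H" and J: "subgraph_of J (Ugraph {..<n} X)" and iso: "isomorphic J H"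
  shows "\<exists>g \<in> embs H n. copy H g = edges J"
proof -
  obtain f where f: "bij_betw f (verts J) (verts H)"
    and fe: "\<And>u v. u \<in> verts J \<Longrightarrow> v \<in> verts J \<Longrightarrow> {u, v} \<in> edges J \<longleftrightarrow> {f u, f v} \<in> edges H"
    using iso by (auto simp: isomorphic_def)
  have sJ: "simple_graph J" and vJ: "verts J \<subseteq> {..<n}" using J by (auto simp: subgraph_of_def)
  \<comment> \<open>The embedding is the inverse of the isomorphism; the restriction makes it
    extensional, as \<open>embs\<close> demands.\<close>
  define g where "g = restrict (inv_into (verts J) f) (verts H)"
  have gb: "bij_betw g (verts H) (verts J)"
    using bij_betw_inv_into[OF f] unfolding g_def by (rule bij_betw_cong[THEN iffD1, rotated]) simp
  have gf: "g (f u) = u" if "u \<in> verts J" for u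
    using that f by (simp add: g_def bij_betw_inv_into_left bij_betwE)
  have fg: "f (g x) = x" "g x \<in> verts J" if "x \<in> verts H" for x
    using that f gb by (auto simp: g_def bij_betw_inv_into_right bij_betw_def)
  have "g \<in> embs H n"
    using gb vJ fg by (auto simp: embs_def bij_betw_def g_def PiE_def Pi_def)
  moreover have "copy H g = edges J"
  proof (intro equalityI subsetI)
    fix e assume "e \<in> copy H g"
    then obtain e' where e': "e' \<in> edges H" "e = g ` e'" by (auto simp: copy_def)
    then obtain x where "x \<in> e'" using simple_graph_edge_card[OF H] by fastforce
    then obtain y where y: "e' = {x, y}" "y \<in> verts H" using edge_pair[OF H e'(1)] by metis
    have "x \<in> verts H" using simple_graph_edge_subset[OF H e'(1)] y by auto
    then show "e \<in> edges J" using fe[of "g x" "g y"] fg y e' by auto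
  next
    fix e assume e: "e \<in> edges J"
    then obtain x where "x \<in> e" using simple_graph_edge_card[OF sJ] by fastforce
    then obtain y where y: "e = {x, y}" "y \<in> verts J" using edge_pair[OF sJ e] by metis
    have x: "x \<in> verts J" using simple_graph_edge_subset[OF sJ e] y by auto
    then have "{f x, f y} \<in> edges H" using fe y e by auto
    moreover have "e = g ` {f x, f y}" using gf x y by auto
    ultimately show "e \<in> copy H g" unfolding copy_def by (rule rev_image_eqI)
  qed
  ultimately show ?thesis by blast
qed

lemma copy_imp_isomorphic:
  assumes H: "simple_graph H" and g: "g \<in> embs H n" "copy H g \<subseteq> X"
  defines "J \<equiv> Ugraph (g ` verts H) (copy H g)"
  shows "subgraph_of J (Ugraph {..<n} X)" "isomorphic J H"
proof -
  have ns: "copy H g \<subseteq> nsets (g ` verts H) 2"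
  proof
    fix f assume f: "f \<in> copy H g"
    then have "f \<subseteq> g ` verts H" using simple_graph_edge_subset[OF H] by (auto simp: copy_def)
    with f copy_nsets[OF H g(1)] show "f \<in> nsets (g ` verts H) 2" by (auto simp: nsets_def)
  qed
  then show "subgraph_of J (Ugraph {..<n} X)"
    using g in_embsD[OF g(1)] simple_graph_finite[OF H]
    by (auto simp: J_def subgraph_of_def simple_graph_def)
  let ?f = "inv_into (verts H) g"
  have inj: "inj_on g (verts H)" using in_embsD[OF g(1)] by simp
  have "bij_betw ?f (g ` verts H) (verts H)"
    using inj by (simp add: bij_betw_inv_into inj_on_imp_bij_betw)
  moreover have "{g x, g y} \<in> copy H g \<longleftrightarrow> {x, y} \<in> edges H" if "x \<in> verts H" "y \<in> verts H" for x y
  proof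
    assume "{g x, g y} \<in> copy H g"
    then obtain e where "e \<in> edges H" "g ` {x, y} = g ` e" by (auto simp: copy_def)
    then have "{x, y} = e" using inj that simple_graph_edge_subset[OF H]
      by (metis empty_subsetI inj_on_image_eq_iff insert_subset)
    then show "{x, y} \<in> edges H" using \<open>e \<in> edges H\<close> by simp
  next
    assume "{x, y} \<in> edges H"
    then have "g ` {x, y} \<in> copy H g" unfolding copy_def by (rule imageI)
    then show "{g x, g y} \<in> copy H g" by simp
  qed
  ultimately show "isomorphic J H"
    unfolding isomorphic_def by (intro exI[of _ ?f]) (auto simp: J_def inj)
qed

text \<open>Replaces the quantifier over subgraphs by one over embeddings, so that from here on only
  the edge set \<open>X\<close> matters: minimality, recolouring and union bounds all act on
  \<open>X\<close> with the vertex set fixed.\<close>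

lemma anti_ramsey_iff_copy:
  assumes "simple_graph H"
  shows "anti_ramsey (Ugraph {..<n} X) H \<longleftrightarrow>
    (\<forall>col :: nat set \<Rightarrow> nat. proper_edge_colouring (Ugraph {..<n} X) col \<longrightarrow>
      (\<exists>g \<in> embs H n. copy H g \<subseteq> X \<and> inj_on col (copy H g)))" (is "?L \<longleftrightarrow> ?R")
proof
  assume ?L
  show ?R
  proof (intro allI impI)
    fix col :: "nat set \<Rightarrow> nat" assume "proper_edge_colouring (Ugraph {..<n} X) col"
    then obtain J where J: "subgraph_of J (Ugraph {..<n} X)" "isomorphic J H" "inj_on col (edges J)"
      using \<open>?L\<close> by (auto simp: anti_ramsey_def)
    then show "\<exists>g \<in> embs H n. copy H g \<subseteq> X \<and> inj_on col (copy H g)"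
      using isomorphic_imp_copy[OF assms J(1,2)] J(1,3) by (metis subgraph_of_def ugraph.sel(2))
  qed
next
  assume R: ?R
  show ?L unfolding anti_ramsey_def
  proof (intro allI impI)
    fix col :: "nat set \<Rightarrow> nat" assume "proper_edge_colouring (Ugraph {..<n} X) col"
    then obtain g where "g \<in> embs H n" "copy H g \<subseteq> X" "inj_on col (copy H g)"
      using R by blast
    with copy_imp_isomorphic[OF assms this(1,2)]
    show "\<exists>J. subgraph_of J (Ugraph {..<n} X) \<and> isomorphic J H \<and> inj_on col (edges J)"
      by (intro exI[of _ "Ugraph (g ` verts H) (copy H g)"]) simp
  qed
qed

lemma edges_at_copy:
  assumes H: "simple_graph H" and g: "inj_on g (verts H)" and x: "x \<in> verts H"
  shows "card (edges_at (copy H g) (g x)) = degree_of H x"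
proof -
  have "edges_at (copy H g) (g x) = (\<lambda>e. g ` e) ` {e \<in> edges H. x \<in> e}"
    using inj_on_image_mem_iff[OF g x] simple_graph_edge_subset[OF H]
    by (auto simp: edges_at_def copy_def)
  moreover have "inj_on (\<lambda>e. g ` e) {e \<in> edges H. x \<in> e}"
    using inj_on_image_edges[OF H g] by (rule inj_on_subset) auto
  ultimately show ?thesis by (simp add: card_image degree_of_def)
qed

lemma min_degree_le:
  assumes "simple_graph H" "x \<in> verts H"
  shows "min_degree H \<le> degree_of H x"
  using assms by (simp add: min_degree_def simple_graph_finite)

lemma copy_degree_ge:
  assumes H: "simple_graph H" and g: "inj_on g (verts H)" and f: "f \<in> copy H g" "v \<in> f"
  shows "min_degree H \<le> card (edges_at (copy H g) v)"
proof -
  obtain e x where "e \<in> edges H" "v = g x" "x \<in> e" using f by (auto simp: copy_def)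
  then have "x \<in> verts H" using simple_graph_edge_subset[OF H] by auto
  then show ?thesis using edges_at_copy[OF H g] min_degree_le[OF H] \<open>v = g x\<close> by metis
qed

subsection \<open>Colouring minimal graphs and exploring them\<close>

text \<open>The invariant of the exploration: it forces degree at least \<open>min_degree H\<close>
  in \<open>F\<close> at every vertex that \<open>F\<close> touches.\<close>

definition union_of_copies :: "'a ugraph \<Rightarrow> nat \<Rightarrow> nat set set \<Rightarrow> bool" where
  "union_of_copies H n F \<longleftrightarrow> (\<forall>f\<in>F. \<exists>g\<in>embs H n. copy H g \<subseteq> F \<and> f \<in> copy H g)"

text \<open>A copy through \<open>v\<close> that avoids all edges of \<open>F\<close> there is
  allowed, since the recolouring is concerned only with copies that meet those edges.\<close>

definition closed_at :: "'a ugraph \<Rightarrow> nat \<Rightarrow> nat set set \<Rightarrow> nat set set \<Rightarrow> nat \<Rightarrow> bool" where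
  "closed_at H n X F v \<longleftrightarrow> (\<forall>g\<in>embs H n. copy H g \<subseteq> X \<longrightarrow>
     edges_at (copy H g) v \<inter> F \<noteq> {} \<longrightarrow> edges_at (copy H g) v \<subseteq> F)"

lemma union_of_copies_degree_ge:
  assumes "simple_graph H" "union_of_copies H n F" "finite F" "v \<in> \<Union>F"
  shows "min_degree H \<le> card (edges_at F v)"
proof -
  obtain f g where f: "f \<in> F" "v \<in> f" "g \<in> embs H n" "copy H g \<subseteq> F" "f \<in> copy H g"
    using assms by (auto simp: union_of_copies_def)
  then have "min_degree H \<le> card (edges_at (copy H g) v)"
    using copy_degree_ge[OF assms(1) in_embsD(1)] by blast
  also have "\<dots> \<le> card (edges_at F v)"
    using f assms(3) by (intro card_mono) (auto simp: edges_at_def)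
  finally show ?thesis .
qed

text \<open>Closedness places the edges of the copy at \<open>v\<close> among the edges of
  \<open>F\<close> at \<open>v\<close>. The former number at least \<open>min_degree H\<close>, the
  latter exactly that many, so the two sets coincide.\<close>

lemma closed_at_copy_contains:
  assumes H: "simple_graph H" and g: "g \<in> embs H n" "copy H g \<subseteq> X"
    and cl: "closed_at H n X F v" and F: "finite F" "card (edges_at F v) = min_degree H"
    and f: "f \<in> copy H g" "f \<in> edges_at F v"
  shows "edges_at F v \<subseteq> copy H g"
proof -
  have "v \<in> f" "f \<in> F" using f by (auto simp: edges_at_def)
  then have "edges_at (copy H g) v \<subseteq> F"
    using cl g f(1) unfolding closed_at_def edges_at_def by blast
  then have sub: "edges_at (copy H g) v \<subseteq> edges_at F v" by (auto simp: edges_at_def)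
  have "card (edges_at F v) \<le> card (edges_at (copy H g) v)"
    using copy_degree_ge[OF H in_embsD(1)[OF g(1)] f(1) \<open>v \<in> f\<close>] F by simp
  then have "edges_at (copy H g) v = edges_at F v"
    using sub F by (intro card_seteq) (auto simp: edges_at_def)
  then show ?thesis by (auto simp: edges_at_def)
qed

text \<open>Every copy of \<open>H\<close> meeting the edges at \<open>u\<close> or \<open>v\<close> contains all of them. Hence those edges can
  be coloured last, giving two disjoint ones among them a common fresh colour.\<close>

lemma minimal_anti_ramsey_no_adjacent:
  assumes H: "simple_graph H" and d: "2 \<le> min_degree H"
    and tri: "min_degree H = 2 \<Longrightarrow>
      \<not> (\<exists>x y z. {x, y} \<in> edges H \<and> {y, z} \<in> edges H \<and> {x, z} \<in> edges H)"
    and X: "X \<subseteq> nsets {..<n} 2" "anti_ramsey (Ugraph {..<n} X) H"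
    and minimal: "\<And>X'. X' \<subset> X \<Longrightarrow> \<not> anti_ramsey (Ugraph {..<n} X') H"
    and F: "F \<subseteq> X" "union_of_copies H n F" and uv: "{u, v} \<in> F"
    and du: "card (edges_at F u) = min_degree H" and dv: "card (edges_at F v) = min_degree H"
    and cu: "closed_at H n X F u" and cv: "closed_at H n X F v"
  shows False
proof -
  have finX: "finite X" by (rule finite_subset[OF X(1)]) (simp add: finite_imp_finite_nsets)
  then have finF: "finite F" using F finite_subset by blast
  have pairs: "f \<in> F \<Longrightarrow> card f = 2" for f using F X by (auto simp: nsets_def)
  have "u \<noteq> v" using pairs[OF uv] by auto
  define R where "R = edges_at F u \<union> edges_at F v"
  have uvR: "{u, v} \<in> edges_at F u" "{u, v} \<in> edges_at F v" using uv by (auto simp: edges_at_def)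
  have finR: "finite R" "R \<subseteq> X" using finF F by (auto simp: R_def edges_at_def)
  \<comment> \<open>The shared edge \<open>{u, v}\<close> links the two stars: a copy meeting the
    edges at one end contains \<open>{u, v}\<close>, hence meets and contains the edges at the other
    end too.\<close>
  have all: "R \<subseteq> copy H g" if g: "g \<in> embs H n" "copy H g \<subseteq> X" and f: "f \<in> copy H g" "f \<in> R" for g f
  proof -
    note U = closed_at_copy_contains[OF H g cu finF du]
    note V = closed_at_copy_contains[OF H g cv finF dv]
    from f(2) show ?thesis unfolding R_def
      using U[OF f(1)] V[OF f(1)] U[of "{u, v}"] V[of "{u, v}"] uvR by blast
  qed
  \<comment> \<open>Pick a second edge \<open>{u, x}\<close> at \<open>u\<close>. A disjoint edge at
    \<open>v\<close> must differ from \<open>{u, v}\<close> and \<open>{v, x}\<close>; if there is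
    none, then the minimum degree is 2 and a single copy contains the triangle \<open>u\<close>,
    \<open>v\<close>, \<open>x\<close>, which \<open>tri\<close> forbids.\<close>
  obtain a b where ab: "a \<in> edges_at F u" "b \<in> edges_at F v" "a \<inter> b = {}"
  proof -
    have "edges_at F u - {{u, v}} \<noteq> {}"
    proof
      assume "edges_at F u - {{u, v}} = {}"
      then have "card (edges_at F u) \<le> card {{u, v}}" by (intro card_mono) auto
      then show False using du d by simp
    qed
    then obtain a where a: "a \<in> edges_at F u" "a \<noteq> {u, v}" by blast
    then have "card a = 2" "u \<in> a" using pairs by (auto simp: edges_at_def)
    then obtain x where x: "a = {u, x}" "x \<noteq> u"
      by (metis card_2_iff doubleton_eq_iff insertE singletonD)
    have xv: "x \<noteq> v" using a x by auto
    have "edges_at F v - {{u, v}, {v, x}} \<noteq> {}"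
    proof
      assume *: "edges_at F v - {{u, v}, {v, x}} = {}"
      have c2: "card {{u, v}, {v, x}} \<le> 2" by (simp add: card_insert_if)
      have sub: "edges_at F v \<subseteq> {{u, v}, {v, x}}" using * by auto
      then have "card (edges_at F v) \<le> card {{u, v}, {v, x}}" by (intro card_mono) auto
      then have two: "min_degree H = 2" "card {{u, v}, {v, x}} \<le> card (edges_at F v)"
        using c2 d dv by auto
      then have "edges_at F v = {{u, v}, {v, x}}" using sub by (intro card_seteq) auto
      moreover obtain g where g: "g \<in> embs H n" "copy H g \<subseteq> F" "{u, v} \<in> copy H g"
        using F(2) uv by (auto simp: union_of_copies_def)
      ultimately have "{u, x} \<in> copy H g" "{v, x} \<in> copy H g"
        using all[OF g(1) _ g(3)] g(2) F(1) uvR a x by (auto simp: R_def)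
      then obtain e1 e2 e3 where e: "e1 \<in> edges H" "e2 \<in> edges H" "e3 \<in> edges H"
        "g ` e1 = {u, v}" "g ` e2 = {u, x}" "g ` e3 = {v, x}"
        using g(3) by (auto simp: copy_def)
      have sub: "e1 \<subseteq> verts H" "e2 \<subseteq> verts H" "e3 \<subseteq> verts H"
        using e simple_graph_edge_subset[OF H] by auto
      have inj: "inj_on g (verts H)" using in_embsD(1)[OF g(1)] .
      obtain u' where u': "u' \<in> e1" "g u' = u" using e(4) by (metis imageE insertI1)
      obtain v' where v': "v' \<in> e1" "g v' = v" using e(4) by (metis imageE insertI1 insert_commute)
      obtain x' where x': "x' \<in> e2" "g x' = x" using e(5) by (metis imageE insertI1 insert_commute)
      have vs: "u' \<in> verts H" "v' \<in> verts H" "x' \<in> verts H" using sub u' v' x' by auto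
      have "g ` {u', v'} = g ` e1" "g ` {u', x'} = g ` e2" "g ` {v', x'} = g ` e3"
        using e u' v' x' by auto
      then have "{u', v'} = e1" "{u', x'} = e2" "{v', x'} = e3"
        using inj_on_image_eq_iff[OF inj] vs sub by (metis empty_subsetI insert_subset)+
      then show False using tri[OF two(1)] e(1-3) by blast
    qed
    then obtain b where b: "b \<in> edges_at F v" "b \<noteq> {u, v}" "b \<noteq> {v, x}" by blast
    then have "card b = 2" "v \<in> b" using pairs by (auto simp: edges_at_def)
    then obtain y where y: "b = {v, y}" "y \<noteq> v"
      by (metis card_2_iff doubleton_eq_iff insertE singletonD)
    then have "a \<inter> b = {}" using x xv b \<open>u \<noteq> v\<close> by (auto simp: insert_commute)
    then show ?thesis using that a b by blast
  qed
  have abR: "a \<in> R" "b \<in> R" and abne: "a \<noteq> b" using ab by (auto simp: R_def edges_at_def)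
  have "X - R \<subset> X" using finR uvR by (auto simp: R_def)
  then obtain col :: "nat set \<Rightarrow> nat" where col: "proper_edge_colouring (Ugraph {..<n} (X - R)) col"
    and nocol: "\<And>g. g \<in> embs H n \<Longrightarrow> copy H g \<subseteq> X - R \<Longrightarrow> \<not> inj_on col (copy H g)"
    using minimal anti_ramsey_iff_copy[OF H] by meson
  obtain m where m: "\<And>e. e \<in> X \<Longrightarrow> col e < m"
    using finite_nat_set_iff_bounded[of "col ` X"] finX by auto
  obtain i :: "nat set \<Rightarrow> nat" where i: "inj_on i R"
    using finite_imp_inj_to_nat_seg[OF finR(1)] by blast
  define rep where "rep e = (if e = b then a else e)" for e
  define col' where "col' e = (if e \<in> R then m + i (rep e) else col e)" for e
  have repR: "rep e \<in> R" if "e \<in> R" for e using that abR by (simp add: rep_def)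
  have "proper_edge_colouring (Ugraph {..<n} X) col'"
    unfolding proper_edge_colouring_def
  proof (intro ballI impI)
    fix e e' assume e: "e \<in> edges (Ugraph {..<n} X)" "e' \<in> edges (Ugraph {..<n} X)"
      and ne: "e \<noteq> e' \<and> e \<inter> e' \<noteq> {}"
    show "col' e \<noteq> col' e'"
    proof (cases "e \<in> R"; cases "e' \<in> R")
      assume R: "e \<in> R" "e' \<in> R"
      have "rep e \<noteq> rep e'" using ne ab(3) by (auto simp: rep_def split: if_splits)
      then show ?thesis using i R repR by (auto simp: col'_def inj_on_def)
    next
      assume R: "e \<in> R" "e' \<notin> R"
      then show ?thesis using m[of e'] e by (simp add: col'_def)
    next
      assume R: "e \<notin> R" "e' \<in> R"
      then show ?thesis using m[of e] e by (simp add: col'_def)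
    next
      assume R: "e \<notin> R" "e' \<notin> R"
      then show ?thesis using col e ne by (auto simp: col'_def proper_edge_colouring_def)
    qed
  qed
  then obtain g where g: "g \<in> embs H n" "copy H g \<subseteq> X" "inj_on col' (copy H g)"
    using X(2) anti_ramsey_iff_copy[OF H] by meson
  show False
  \<comment> \<open>A copy avoiding \<open>R\<close> is coloured by \<open>col\<close> and so is not
    rainbow; any other copy contains all of \<open>R\<close>, in particular \<open>a\<close> and
    \<open>b\<close>.\<close>
  proof (cases "copy H g \<inter> R = {}")
    case True
    then have "inj_on col (copy H g)"
      using g(3) by (subst inj_on_cong[of _ _ col']) (auto simp: col'_def)
    then show False using nocol g True by blast
  next
    case False
    then have "a \<in> copy H g" "b \<in> copy H g" using all[OF g(1,2)] abR by blast+
    moreover have "col' a = col' b" using abR by (simp add: col'_def rep_def)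
    ultimately show False using g(3) abne by (meson inj_onD)
  qed
qed

text \<open>Let \<open>A\<close> be the vertices of degree \<open>d\<close> among all vertices
  \<open>W\<close>. The stars at \<open>A\<close> are disjoint, so \<open>d |A| \<le> |F|\<close>;
  the degree sum gives \<open>d |W| + |W - A| \<le> 2 |F|\<close>. Adding \<open>d\<close> times the
  second inequality to the first eliminates \<open>A\<close>.\<close>

lemma independent_low_degree_density:
  fixes F :: "'b set set"
  assumes fin: "finite F" and two: "\<And>f. f \<in> F \<Longrightarrow> card f = 2"
    and deg: "\<And>v. v \<in> \<Union>F \<Longrightarrow> d \<le> card (edges_at F v)"
    and indep: "\<And>u v. {u, v} \<in> F \<Longrightarrow> card (edges_at F u) = d \<Longrightarrow> card (edges_at F v) \<noteq> d"
  shows "d * (d + 1) * card (\<Union>F) \<le> (2 * d + 1) * card F"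
proof -
  define W where "W = \<Union>F"
  define A where "A = {v \<in> W. card (edges_at F v) = d}"
  have finW: "finite W" unfolding W_def
    using fin two by (metis card.infinite finite_Union zero_neq_numeral)
  have finA: "finite A" "A \<subseteq> W" using finW by (auto simp: A_def)
  have fe: "finite (edges_at F v)" for v using fin by (auto simp: edges_at_def)
  have "card (\<Union>v\<in>A. edges_at F v) = (\<Sum>v\<in>A. card (edges_at F v))"
  proof (rule card_UN_disjoint[OF finA(1)])
    show "\<forall>v\<in>A. \<forall>w\<in>A. v \<noteq> w \<longrightarrow> edges_at F v \<inter> edges_at F w = {}"
    proof (intro ballI impI, rule ccontr)
      fix v w assume *: "v \<in> A" "w \<in> A" "v \<noteq> w" "edges_at F v \<inter> edges_at F w \<noteq> {}"
      then obtain f where f: "f \<in> F" "v \<in> f" "w \<in> f" by (auto simp: edges_at_def)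
      then have "f = {v, w}" using two[OF f(1)] *(3)
        by (metis card_2_iff doubleton_eq_iff insertE singletonD)
      then show False using indep[of v w] f * by (auto simp: A_def)
    qed
  qed (use fe in auto)
  moreover have "card (\<Union>v\<in>A. edges_at F v) \<le> card F"
    by (rule card_mono[OF fin]) (auto simp: edges_at_def)
  ultimately have 1: "d * card A \<le> card F" by (simp add: A_def mult.commute)
  have "(\<Sum>v\<in>W. card (edges_at F v)) = (\<Sum>v\<in>W. \<Sum>f\<in>{f\<in>F. v \<in> f}. (1::nat))"
    by (simp add: edges_at_def)
  also have "\<dots> = (\<Sum>f\<in>F. \<Sum>v\<in>{v\<in>W. v \<in> f}. 1)"
    by (rule sum.swap_restrict[OF finW fin])
  also have "\<dots> = (\<Sum>f\<in>F. 2)"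
  proof (rule sum.cong[OF refl])
    fix f assume f: "f \<in> F"
    then have "{v\<in>W. v \<in> f} = f" by (auto simp: W_def)
    then show "(\<Sum>v\<in>{v\<in>W. v \<in> f}. 1) = (2::nat)" using two[OF f] by simp
  qed
  finally have s: "(\<Sum>v\<in>W. card (edges_at F v)) = 2 * card F" by simp
  have "(\<Sum>v\<in>W. d + (if v \<in> A then 0 else 1)) \<le> (\<Sum>v\<in>W. card (edges_at F v))"
  proof (rule sum_mono)
    fix v assume v: "v \<in> W"
    then show "d + (if v \<in> A then 0 else 1) \<le> card (edges_at F v)"
      using deg[of v] by (auto simp: A_def W_def)
  qed
  moreover have "(\<Sum>v\<in>W. (if v \<in> A then 0 else 1)) = card (W - A)"
    using finW by (simp add: sum.If_cases Diff_eq)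
  ultimately have 2: "d * card W + card (W - A) \<le> 2 * card F"
    using s by (simp add: sum.distrib mult.commute)
  have "card W = card A + card (W - A)"
    using finA finW by (metis card_Diff_subset card_mono le_add_diff_inverse)
  then have "d * (d + 1) * card W = d * (d * card W + card (W - A)) + d * card A"
    by (simp add: algebra_simps)
  also have "\<dots> \<le> d * (2 * card F) + card F" using 1 2 by (intro add_mono mult_left_mono) auto
  finally show ?thesis by (simp add: W_def algebra_simps)
qed

section \<open>The exploration process and the graphs at which it stops\<close>

text \<open>The degree condition later limits the choices for an edge of \<open>F\<close> at
  \<open>v\<close> to \<open>min_degree H\<close>. A new edge is demanded anywhere in the copy, not
  only at \<open>v\<close>: this covers every copy violating \<open>closed_at\<close>, and a larger
  family is harmless for upper bounds.\<close>

definition extensions :: "'a ugraph \<Rightarrow> nat \<Rightarrow> nat \<Rightarrow> nat set set \<Rightarrow> ('a \<Rightarrow> nat) set" where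
  "extensions H n v F = {g \<in> embs H n. card (edges_at F v) \<le> min_degree H \<and>
     edges_at (copy H g) v \<inter> F \<noteq> {} \<and> \<not> copy H g \<subseteq> F}"

text \<open>Every step handles one vertex of the queue \<open>q\<close>. Skipping is always allowed, which makes the
  predicate monotone in \<open>X\<close> and costs only a factor 2 per step in the union bound.\<close>

primrec explore :: "'a ugraph \<Rightarrow> nat \<Rightarrow> nat set set \<Rightarrow> nat \<Rightarrow> nat set \<Rightarrow> nat set set \<Rightarrow> bool" where
  "explore H n X 0 q F \<longleftrightarrow> True"
| "explore H n X (Suc k) q F \<longleftrightarrow> q \<noteq> {} \<and>
     (explore H n X k (q - {Min q}) F \<or>
      (\<exists>g\<in>extensions H n (Min q) F. copy H g \<subseteq> X \<and>
         explore H n X k (q - {Min q} \<union> (\<Union>(copy H g) - \<Union>F)) (F \<union> copy H g)))"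

lemma explore_mono: "explore H n X k q F \<Longrightarrow> X \<subseteq> Y \<Longrightarrow> explore H n Y k q F"
  by (induction k arbitrary: q F) fastforce+

text \<open>Follow one particular run: skip \<open>v\<close> if it is settled (large degree or
  closed), otherwise add a copy violating closedness. Settled vertices stay settled: if the edges at
  \<open>w\<close> do not change, neither does closedness, and if one is added, the degree rises
  above \<open>min_degree H\<close>, which was a lower bound already. Since \<open>explore\<close>
  fails, the queue empties within \<open>k\<close> steps, and each step handles only one
  vertex.\<close>

lemma not_explore_imp_closed:
  assumes H: "simple_graph H" and X: "finite X" "\<And>f. f \<in> X \<Longrightarrow> finite f"
    and "\<not> explore H n X k q F" "F \<subseteq> X" "union_of_copies H n F" "q \<subseteq> \<Union>F"
    and "\<And>w. w \<in> \<Union>F - q \<Longrightarrow> min_degree H < card (edges_at F w) \<or> closed_at H n X F w"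
  shows "\<exists>F'. F \<subseteq> F' \<and> F' \<subseteq> X \<and> union_of_copies H n F' \<and> card (\<Union>F') \<le> card (\<Union>F - q) + k \<and>
    (\<forall>w\<in>\<Union>F'. min_degree H < card (edges_at F' w) \<or> closed_at H n X F' w)"
  using assms(4-)
proof (induction k arbitrary: q F)
  case 0
  then show ?case by simp
next
  case (Suc k)
  have finF: "finite F" using Suc.prems(2) X(1) finite_subset by blast
  have finW: "finite (\<Union>F)" using finF Suc.prems(2) X(2) by blast
  show ?case
  proof (cases "q = {}")
    case True
    then show ?thesis using Suc.prems by (intro exI[of _ F]) auto
  next
    case False
    define v where "v = Min q"
    have vq: "v \<in> q" using False Suc.prems(4) finW by (metis Min_in finW finite_subset v_def)
    have new: "card (\<Union>F - (q - {v})) = Suc (card (\<Union>F - q))"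
    proof -
      have "\<Union>F - (q - {v}) = insert v (\<Union>F - q)" using vq Suc.prems(4) by auto
      then show ?thesis using vq finW by simp
    qed
    have nskip: "\<not> explore H n X k (q - {v}) F" using Suc.prems(1) False by (auto simp: v_def)
    show ?thesis
    proof (cases "min_degree H < card (edges_at F v) \<or> closed_at H n X F v")
      case True
      have "\<exists>F'. F \<subseteq> F' \<and> F' \<subseteq> X \<and> union_of_copies H n F' \<and>
          card (\<Union>F') \<le> card (\<Union>F - (q - {v})) + k \<and>
          (\<forall>w\<in>\<Union>F'. min_degree H < card (edges_at F' w) \<or> closed_at H n X F' w)"
        by (rule Suc.IH[OF nskip]) (use Suc.prems True in auto)
      then show ?thesis using new by auto
    next
      case False
      then obtain g where g: "g \<in> embs H n" "copy H g \<subseteq> X" "edges_at (copy H g) v \<inter> F \<noteq> {}"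
        "\<not> edges_at (copy H g) v \<subseteq> F" by (auto simp: closed_at_def)
      have "g \<in> extensions H n v F" using g False by (auto simp: extensions_def edges_at_def)
      define F1 where "F1 = F \<union> copy H g"
      define q1 where "q1 = q - {v} \<union> (\<Union>(copy H g) - \<Union>F)"
      have n1: "\<not> explore H n X k q1 F1"
        using Suc.prems(1) \<open>q \<noteq> {}\<close> g(2) \<open>g \<in> extensions H n v F\<close>
        by (auto simp: v_def F1_def q1_def)
      have finF1: "finite F1" using finF finite_copy[OF H] by (simp add: F1_def)
      have F1X: "F1 \<subseteq> X" using g Suc.prems by (simp add: F1_def)
      have uc: "union_of_copies H n F1"
        using Suc.prems(3) g(1) unfolding union_of_copies_def F1_def by blast
      have q1W: "q1 \<subseteq> \<Union>F1" using Suc.prems(4) by (auto simp: q1_def F1_def)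
      have rem: "\<Union>F1 - q1 = \<Union>F - (q - {v})" using vq Suc.prems(4) by (auto simp: F1_def q1_def)
      have grow: "edges_at F w \<subseteq> edges_at F1 w" for w by (auto simp: edges_at_def F1_def)
      have finE: "finite (edges_at F1 w)" for w using finF1 by (simp add: edges_at_def)
      have done1: "min_degree H < card (edges_at F1 w) \<or> closed_at H n X F1 w" if w: "w \<in> \<Union>F1 - q1" for w
      proof (cases "edges_at F1 w = edges_at F w")
        case True
        have "w \<noteq> v"
        proof
          assume "w = v"
          obtain f where "f \<in> edges_at (copy H g) v" "f \<notin> F" using g(4) by blast
          then have "f \<in> edges_at F1 v" "f \<notin> edges_at F v" by (auto simp: edges_at_def F1_def)
          then show False using True \<open>w = v\<close> by simp
        qed
        then have "w \<in> \<Union>F - q" using w rem by auto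
        then have "min_degree H < card (edges_at F w) \<or> closed_at H n X F w" by (rule Suc.prems(5))
        moreover have "closed_at H n X F w \<Longrightarrow> closed_at H n X F1 w"
          using True unfolding closed_at_def edges_at_def by blast
        ultimately show ?thesis using True by auto
      next
        case False
        then have "edges_at F w \<subset> edges_at F1 w" using grow by blast
        then have "card (edges_at F w) < card (edges_at F1 w)" using finE psubset_card_mono by blast
        moreover have "w \<in> \<Union>F" using w rem by auto
        then have "min_degree H \<le> card (edges_at F w)"
          using union_of_copies_degree_ge[OF H Suc.prems(3) finF] by blast
        ultimately show ?thesis by simp
      qed
      obtain F' where "F1 \<subseteq> F'" "F' \<subseteq> X" "union_of_copies H n F'" "card (\<Union>F') \<le> card (\<Union>F1 - q1) + k"
        "\<forall>w\<in>\<Union>F'. min_degree H < card (edges_at F' w) \<or> closed_at H n X F' w"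
        using Suc.IH[OF n1 F1X uc q1W done1] by blast
      then show ?thesis using new rem by (intro exI[of _ F']) (auto simp: F1_def)
    qed
  qed
qed

lemma anti_ramsey_imp_explore_or_dense:
  assumes H: "simple_graph H" and d: "2 \<le> min_degree H" and ne: "edges H \<noteq> {}"
    and tri: "min_degree H = 2 \<Longrightarrow>
      \<not> (\<exists>x y z. {x, y} \<in> edges H \<and> {y, z} \<in> edges H \<and> {x, z} \<in> edges H)"
    and X: "X \<subseteq> nsets {..<n} 2" "anti_ramsey (Ugraph {..<n} X) H"
  shows "(\<exists>g\<in>embs H n. copy H g \<subseteq> X \<and> explore H n X k (\<Union>(copy H g)) (copy H g)) \<or>
    (\<exists>F. F \<noteq> {} \<and> F \<subseteq> X \<and> card (\<Union>F) \<le> k \<and>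
      min_degree H * (min_degree H + 1) * card (\<Union>F) \<le> (2 * min_degree H + 1) * card F)"
proof -
  have finX: "finite X" by (rule finite_subset[OF X(1)]) (simp add: finite_imp_finite_nsets)
  \<comment> \<open>Minimality makes the recolouring possible. Explorations and dense subgraphs
    found in \<open>Y\<close> are also present in \<open>X\<close>.\<close>
  obtain Y where Y: "Y \<subseteq> X" "anti_ramsey (Ugraph {..<n} Y) H"
    and minimal: "\<And>Y'. Y' \<subset> Y \<Longrightarrow> \<not> anti_ramsey (Ugraph {..<n} Y') H"
  proof -
    let ?S = "{Y. Y \<subseteq> X \<and> anti_ramsey (Ugraph {..<n} Y) H}"
    have "finite ?S" "X \<in> ?S" using finX X by auto
    then obtain Y where "Y \<in> ?S" "\<forall>Z\<in>?S. Z \<subseteq> Y \<longrightarrow> Y = Z"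
      using finite_has_minimal2[of ?S X] by blast
    then show ?thesis using that[of Y] by blast
  qed
  have Y2: "Y \<subseteq> nsets {..<n} 2" using X Y by blast
  have finY: "finite Y" using finX Y finite_subset by blast
  \<comment> \<open>An injective colouring is proper, so being anti-Ramsey yields at least one copy,
    from which the exploration starts.\<close>
  have "\<exists>col :: nat set \<Rightarrow> nat. inj_on col Y"
    using finite_imp_inj_to_nat_seg[OF finY] by blast
  then obtain col :: "nat set \<Rightarrow> nat" where "inj_on col Y" by blast
  then have "proper_edge_colouring (Ugraph {..<n} Y) col"
    by (auto simp: proper_edge_colouring_def inj_on_def)
  then obtain g where g: "g \<in> embs H n" "copy H g \<subseteq> Y"
    using Y(2) anti_ramsey_iff_copy[OF H] by meson
  show ?thesis
  proof (cases "explore H n Y k (\<Union>(copy H g)) (copy H g)")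
    case True
    then have "explore H n X k (\<Union>(copy H g)) (copy H g)" using Y(1) by (rule explore_mono)
    then show ?thesis using g Y(1) by blast
  next
    case False
    have "finite f" if "f \<in> Y" for f using that Y2 by (auto simp: nsets_def)
    moreover have "union_of_copies H n (copy H g)" using g by (auto simp: union_of_copies_def)
    \<comment> \<open>The queue starts with every vertex of the first copy, so no vertex counts as
      handled yet and the vertex bound is just \<open>k\<close>.\<close>
    ultimately have "\<exists>F. copy H g \<subseteq> F \<and> F \<subseteq> Y \<and> union_of_copies H n F \<and>
        card (\<Union>F) \<le> card (\<Union>(copy H g) - \<Union>(copy H g)) + k \<and>
        (\<forall>w\<in>\<Union>F. min_degree H < card (edges_at F w) \<or> closed_at H n Y F w)"
      using not_explore_imp_closed[OF H finY _ False g(2)] by blast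
    then obtain F where F: "copy H g \<subseteq> F" "F \<subseteq> Y" "union_of_copies H n F" "card (\<Union>F) \<le> k"
      and ok: "\<And>w. w \<in> \<Union>F \<Longrightarrow> min_degree H < card (edges_at F w) \<or> closed_at H n Y F w"
      unfolding Diff_cancel card.empty add_0 by blast
    have finF: "finite F" using F finY finite_subset by blast
    have "min_degree H * (min_degree H + 1) * card (\<Union>F) \<le> (2 * min_degree H + 1) * card F"
    proof (rule independent_low_degree_density[OF finF])
      show "card f = 2" if "f \<in> F" for f using that F Y2 by (auto simp: nsets_def)
      show "min_degree H \<le> card (edges_at F v)" if "v \<in> \<Union>F" for v
        using union_of_copies_degree_ge[OF H F(3) finF that] .
      show "card (edges_at F v) \<noteq> min_degree H"
        if "{u, v} \<in> F" "card (edges_at F u) = min_degree H" for u v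
      proof
        assume "card (edges_at F v) = min_degree H"
        moreover have "u \<in> \<Union>F" "v \<in> \<Union>F" using that by auto
        ultimately show False
          using minimal_anti_ramsey_no_adjacent[OF H d tri Y2 Y(2) minimal F(2,3) that(1)]
            that ok[of u] ok[of v] by simp
      qed
    qed
    moreover have "F \<noteq> {}" using F(1) ne by (auto simp: copy_def)
    ultimately show ?thesis using F Y by blast
  qed
qed

subsection \<open>Expected number of explorations\<close>

lemma set_random_graphD:
  "G \<in> set_pmf (random_graph n p) \<Longrightarrow> verts G = {..<n} \<and> edges G \<subseteq> nsets {..<n} 2"
  by (auto simp: random_graph_def)

lemma prob_contains_edges:
  assumes F: "F \<subseteq> nsets {..<n} 2" and p: "0 \<le> p" "p \<le> 1"
  shows "measure_pmf.prob (random_graph n p) {G. F \<subseteq> edges G} = p ^ card F"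
proof -
  let ?A = "nsets {..<n} 2"
  let ?\<mu> = "Pi_pmf ?A False (\<lambda>_. bernoulli_pmf p)"
  have fin: "finite ?A" by (simp add: finite_imp_finite_nsets)
  have "(\<lambda>X. Ugraph {..<n} {e \<in> ?A. X e}) -` {G. F \<subseteq> edges G} =
      Pi ?A (\<lambda>e. if e \<in> F then {True} else UNIV)"
    using F by (auto simp: Pi_def split: if_splits)
  then have "measure_pmf.prob (random_graph n p) {G. F \<subseteq> edges G} =
      measure_pmf.prob ?\<mu> (Pi ?A (\<lambda>e. if e \<in> F then {True} else UNIV))"
    by (simp add: random_graph_def)
  also have "\<dots> = (\<Prod>e\<in>?A. measure_pmf.prob (bernoulli_pmf p) (if e \<in> F then {True} else UNIV))"
    by (rule measure_Pi_pmf_Pi[OF fin])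
  also have "\<dots> = (\<Prod>e\<in>?A. if e \<in> F then p else 1)"
    by (rule prod.cong) (use p in \<open>auto simp: measure_pmf_single\<close>)
  also have "\<dots> = p ^ card F"
    using F fin by (simp add: prod.If_cases Int_absorb1)
  finally show ?thesis .
qed

text \<open>A step shortens the queue by 1 and an extension lengthens it by at most \<open>v(H)\<close>. Charging a
  factor \<open>lam\<close> per unit of queue length therefore lets each extension, of weight at most
  \<open>lam ^ v(H)\<close>, pay for the vertices that it adds.\<close>

lemma prob_explore_le:
  fixes p lam :: real
  assumes H: "simple_graph H" and p: "0 \<le> p" "p \<le> 1" and lam: "0 < lam" "lam \<le> 1"
    and ext: "\<And>v F. F \<subseteq> nsets {..<n} 2 \<Longrightarrow> card (\<Union>F) \<le> N \<Longrightarrow>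
      (\<Sum>g\<in>extensions H n v F. p ^ card (copy H g - F)) \<le> lam ^ card (verts H)"
    and "F \<subseteq> nsets {..<n} 2" "q \<subseteq> \<Union>F" "card (\<Union>F) + card (verts H) * k \<le> N"
  shows "measure_pmf.prob (random_graph n p)
      {G. F \<subseteq> edges G \<and> explore H n (edges G) k q F} \<le> p ^ card F * (2 * lam) ^ k / lam ^ card q"
  using assms(7-)
proof (induction k arbitrary: q F)
  case 0
  have "p ^ card F * 1 \<le> p ^ card F * (1 / lam ^ card q)"
    using lam p by (intro mult_left_mono) (auto simp: power_le_one)
  then show ?case using prob_contains_edges[OF 0(1) p] by simp
next
  case (Suc k)
  let ?M = "measure_pmf.prob (random_graph n p)"
  let ?h = "card (verts H)"
  show ?case
  proof (cases "q = {}")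
    case True
    then show ?thesis using p lam by simp
  next
    case False
    define v where "v = Min q"
    have subn: "\<Union>F \<subseteq> {..<n}" using Suc.prems(1) by (auto simp: nsets_def)
    have finW: "finite (\<Union>F)" using subn by (rule finite_subset) simp
    have finF: "finite F" using Suc.prems(1) by (rule finite_subset) (simp add: finite_imp_finite_nsets)
    have finq: "finite q" using Suc.prems(2) finW finite_subset by blast
    have vq: "v \<in> q" using False finq by (simp add: v_def)
    have cq: "card q = Suc (card (q - {v}))" using vq finq by (metis card_Suc_Diff1)
    define E where "E q F = {G :: nat ugraph. F \<subseteq> edges G \<and> explore H n (edges G) k q F}" for q F
    define r where "r g = q - {v} \<union> (\<Union>(copy H g) - \<Union>F)" for g
    let ?X = "extensions H n v F"
    have finX: "finite ?X" using finite_embs[OF H] by (simp add: extensions_def)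
    \<comment> \<open>The first step either skips or adds one extension. Because
      \<open>F \<subseteq> edges G\<close> is part of the event, both branches are again events of
      the same form with \<open>k\<close> steps left.\<close>
    have "{G. F \<subseteq> edges G \<and> explore H n (edges G) (Suc k) q F} \<subseteq>
        E (q - {v}) F \<union> (\<Union>g\<in>?X. E (r g) (F \<union> copy H g))"
      by (auto simp: E_def r_def v_def)
    then have "?M {G. F \<subseteq> edges G \<and> explore H n (edges G) (Suc k) q F} \<le>
        ?M (E (q - {v}) F \<union> (\<Union>g\<in>?X. E (r g) (F \<union> copy H g)))"
      by (intro measure_pmf.finite_measure_mono) auto
    also have "\<dots> \<le> ?M (E (q - {v}) F) + ?M (\<Union>g\<in>?X. E (r g) (F \<union> copy H g))"
      by (rule measure_Un_le) auto
    also have "?M (\<Union>g\<in>?X. E (r g) (F \<union> copy H g)) \<le> (\<Sum>g\<in>?X. ?M (E (r g) (F \<union> copy H g)))"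
      by (rule measure_UNION_le[OF finX]) auto
    also have "?M (E (q - {v}) F) \<le> p ^ card F * (2 * lam) ^ k / lam ^ card (q - {v})"
      unfolding E_def by (rule Suc.IH) (use Suc.prems in auto)
    \<comment> \<open>New edges cost \<open>p ^ card (copy H g - F)\<close>. The queue gains at most
      \<open>card (verts H)\<close> vertices; the resulting power of \<open>lam\<close> in the
      denominator is what \<open>ext\<close> cancels.\<close>
    also have "(\<Sum>g\<in>?X. ?M (E (r g) (F \<union> copy H g))) \<le>
        (\<Sum>g\<in>?X. p ^ card (copy H g - F) * (p ^ card F * (2 * lam) ^ k / lam ^ (card (q - {v}) + ?h)))"
    proof (rule sum_mono)
      fix g assume "g \<in> ?X"
      then have g: "g \<in> embs H n" by (simp add: extensions_def)
      have "\<Union>(copy H g) \<subseteq> g ` verts H" using simple_graph_edge_subset[OF H] by (auto simp: copy_def)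
      moreover have "finite (verts H)" using simple_graph_finite[OF H] by simp
      ultimately have cc: "finite (\<Union>(copy H g))" "card (\<Union>(copy H g)) \<le> ?h"
        by (auto intro: finite_subset) (meson card_image_le card_mono finite_imageI le_trans)
      have W: "card (\<Union>(F \<union> copy H g)) \<le> card (\<Union>F) + ?h"
        using card_Un_le[of "\<Union>F" "\<Union>(copy H g)"] cc by simp
      have "card (r g) \<le> card (q - {v}) + card (\<Union>(copy H g) - \<Union>F)"
        unfolding r_def by (rule card_Un_le)
      also have "card (\<Union>(copy H g) - \<Union>F) \<le> card (\<Union>(copy H g))"
        using cc by (intro card_mono) auto
      finally have cr: "card (r g) \<le> card (q - {v}) + ?h" using cc by simp
      have "card (F \<union> copy H g) = card F + card (copy H g - F)"
        using finF finite_copy[OF H]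
        by (metis Diff_disjoint Un_Diff_cancel card_Un_disjoint finite_Diff)
      then have pc: "p ^ card (F \<union> copy H g) = p ^ card F * p ^ card (copy H g - F)"
        by (simp add: power_add)
      have "?M (E (r g) (F \<union> copy H g)) \<le>
          p ^ card (F \<union> copy H g) * (2 * lam) ^ k / lam ^ card (r g)"
        unfolding E_def
      proof (rule Suc.IH)
        show "F \<union> copy H g \<subseteq> nsets {..<n} 2" using Suc.prems(1) copy_nsets[OF H g] by simp
        show "r g \<subseteq> \<Union>(F \<union> copy H g)" using Suc.prems(2) by (auto simp: r_def)
        show "card (\<Union>(F \<union> copy H g)) + ?h * k \<le> N" using W Suc.prems(3) by simp
      qed
      also have "\<dots> \<le> p ^ card (F \<union> copy H g) * (2 * lam) ^ k / lam ^ (card (q - {v}) + ?h)"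
        using cr lam p by (intro divide_left_mono power_decreasing mult_nonneg_nonneg) auto
      finally show "?M (E (r g) (F \<union> copy H g)) \<le>
          p ^ card (copy H g - F) * (p ^ card F * (2 * lam) ^ k / lam ^ (card (q - {v}) + ?h))"
        by (simp add: pc mult_ac)
    qed
    also have "\<dots> = (\<Sum>g\<in>?X. p ^ card (copy H g - F)) *
        (p ^ card F * (2 * lam) ^ k / lam ^ (card (q - {v}) + ?h))"
      by (rule sum_distrib_right[symmetric])
    also have "\<dots> \<le> lam ^ ?h * (p ^ card F * (2 * lam) ^ k / lam ^ (card (q - {v}) + ?h))"
      by (intro mult_right_mono ext) (use Suc.prems p lam in auto)
    also have "\<dots> = p ^ card F * (2 * lam) ^ k / lam ^ card (q - {v})"
      using lam by (simp add: power_add)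
    \<comment> \<open>Skipping and extending obey the same bound, whence the 2; the vertex removed
      from the queue supplies the missing factor \<open>lam\<close>.\<close>
    finally have "?M {G. F \<subseteq> edges G \<and> explore H n (edges G) (Suc k) q F} \<le>
        2 * (p ^ card F * (2 * lam) ^ k / lam ^ card (q - {v}))" by linarith
    also have "\<dots> = p ^ card F * (2 * lam) ^ Suc k / lam ^ card q"
      using lam by (simp add: cq)
    finally show ?thesis .
  qed
qed

section \<open>Counting extensions by their overlap with the explored graph\<close>

text \<open>A weighted union bound: each \<open>x\<close> is charged to every class
  \<open>A i\<close> containing it, and there is at least one. Below, a class collects the
  embeddings with one overlap pattern, \<open>c i\<close> bounds their number and \<open>b i\<close>
  their weight.\<close>

lemma sum_le_sum_cover:
  fixes f :: "'b \<Rightarrow> real"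
  assumes "finite I" "\<And>i. i \<in> I \<Longrightarrow> finite (A i)" "D \<subseteq> (\<Union>i\<in>I. A i)" "\<And>x. x \<in> D \<Longrightarrow> 0 \<le> f x"
    and b: "\<And>i x. i \<in> I \<Longrightarrow> x \<in> D \<Longrightarrow> x \<in> A i \<Longrightarrow> f x \<le> b i" "\<And>i. i \<in> I \<Longrightarrow> 0 \<le> b i"
    and c: "\<And>i. i \<in> I \<Longrightarrow> real (card (A i)) \<le> c i"
  shows "sum f D \<le> (\<Sum>i\<in>I. c i * b i)"
proof -
  have finD: "finite D" using assms(1-3) by (meson finite_UN_I finite_subset)
  have "sum f D \<le> (\<Sum>x\<in>D. \<Sum>i\<in>{i\<in>I. x \<in> A i}. f x)"
  proof (rule sum_mono)
    fix x assume x: "x \<in> D"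
    then obtain i where "i \<in> {i\<in>I. x \<in> A i}" using assms(3) by blast
    then have "card {i\<in>I. x \<in> A i} \<noteq> 0" using assms(1) by auto
    then have "1 \<le> real (card {i\<in>I. x \<in> A i})" by linarith
    then have "1 * f x \<le> real (card {i\<in>I. x \<in> A i}) * f x"
      using assms(4)[OF x] by (rule mult_right_mono)
    then show "f x \<le> (\<Sum>i\<in>{i\<in>I. x \<in> A i}. f x)" by simp
  qed
  also have "\<dots> = (\<Sum>i\<in>I. \<Sum>x\<in>{x\<in>D. x \<in> A i}. f x)"
    by (rule sum.swap_restrict[OF finD assms(1)])
  also have "\<dots> \<le> (\<Sum>i\<in>I. c i * b i)"
  proof (rule sum_mono)
    fix i assume i: "i \<in> I"
    have "(\<Sum>x\<in>{x\<in>D. x \<in> A i}. f x) \<le> real (card {x\<in>D. x \<in> A i}) * b i"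
      using b(1)[OF i] by (intro sum_bounded_above) auto
    also have "\<dots> \<le> c i * b i"
    proof (rule mult_right_mono[OF _ b(2)[OF i]])
      have "card {x\<in>D. x \<in> A i} \<le> card (A i)" using assms(2)[OF i] by (intro card_mono) auto
      then show "real (card {x\<in>D. x \<in> A i}) \<le> c i" using c[OF i] by linarith
    qed
    finally show "(\<Sum>x\<in>{x\<in>D. x \<in> A i}. f x) \<le> c i * b i" .
  qed
  finally show ?thesis .
qed

text \<open>The ways in which a copy of \<open>H\<close> may overlap a given graph in more than a single edge:
  \<open>U\<close> is the set of vertices and \<open>D\<close> the set of edges of \<open>H\<close> that are mapped into that graph.\<close>

definition overlaps :: "'a ugraph \<Rightarrow> ('a set \<times> 'a set set) set" where
  "overlaps H = {(U, D). U \<subseteq> verts H \<and> 3 \<le> card U \<and> D \<subseteq> edges H \<and> D \<subseteq> nsets U 2 \<and>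
     D \<noteq> {} \<and> D \<noteq> edges H}"

lemma finite_overlaps: "simple_graph H \<Longrightarrow> finite (overlaps H)"
  by (rule finite_subset[of _ "Pow (verts H) \<times> Pow (edges H)"])
    (auto simp: overlaps_def simple_graph_finite)

text \<open>Split by the number of vertices of \<open>H\<close> mapped into
  \<open>\<Union>F\<close>. With fewer than three, the copy shares exactly one edge with
  \<open>F\<close>, and it lies at \<open>v\<close>: one end goes to \<open>v\<close>, the other to
  one of at most \<open>min_degree H\<close> neighbours, and the remaining vertices are free; the
  square counts the ordered pairs of ends. With three or more, the overlap pattern belongs to
  \<open>overlaps H\<close>.\<close>

lemma sum_extensions_le:
  fixes p :: real
  assumes H: "simple_graph H" and p: "0 \<le> p" and F: "F \<subseteq> nsets {..<n} 2" and N: "card (\<Union>F) \<le> N"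
  shows "(\<Sum>g\<in>extensions H n v F. p ^ card (copy H g - F)) \<le>
      real (card (verts H)) ^ 2 * real (min_degree H) *
        (real n ^ (card (verts H) - 2) * p ^ (card (edges H) - 1)) +
      (\<Sum>(U, D)\<in>overlaps H. real N ^ card U * real n ^ (card (verts H) - card U) *
        p ^ (card (edges H) - card D))"
proof -
  let ?V = "verts H" and ?E = "edges H" and ?X = "extensions H n v F" and ?W = "\<Union>F"
  let ?f = "\<lambda>g. p ^ card (copy H g - F)"
  have fin: "finite ?V" "finite ?E" using simple_graph_finite[OF H] by auto
  have finF: "finite F" using F by (rule finite_subset) (simp add: finite_imp_finite_nsets)
  have subn: "?W \<subseteq> {..<n}" using F by (auto simp: nsets_def)
  have finW: "finite ?W" using subn by (rule finite_subset) simp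
  have finX: "finite ?X" using finite_embs[OF H] by (simp add: extensions_def)
  define B where "B g = {x \<in> ?V. g x \<in> ?W}" for g
  define C where "C g = {e \<in> ?E. g ` e \<in> F}" for g
  have g_embs: "g \<in> embs H n" if "g \<in> ?X" for g using that by (simp add: extensions_def)
  have CB: "C g \<subseteq> nsets (B g) 2" if "g \<in> ?X" for g
  proof
    fix e assume e: "e \<in> C g"
    then have "e \<subseteq> B g" using simple_graph_edge_subset[OF H] by (auto simp: B_def C_def)
    moreover have "card e = 2" using e simple_graph_edge_card[OF H] by (auto simp: C_def)
    ultimately show "e \<in> nsets (B g) 2" using fin by (auto simp: nsets_def B_def intro: finite_subset)
  qed
  have Cne: "C g \<noteq> {}" "C g \<noteq> ?E" if "g \<in> ?X" for g
    using that by (auto simp: extensions_def edges_at_def copy_def C_def)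
  have cardC: "card (copy H g - F) = card ?E - card (C g)" if "g \<in> ?X" for g
  proof -
    have "copy H g - F = (\<lambda>e. g ` e) ` (?E - C g)" by (auto simp: copy_def C_def)
    moreover have "inj_on (\<lambda>e. g ` e) (?E - C g)"
      using inj_on_image_edges[OF H in_embsD(1)[OF g_embs[OF that]]] by (rule inj_on_subset) auto
    ultimately have "card (copy H g - F) = card (?E - C g)" by (simp add: card_image)
    also have "\<dots> = card ?E - card (C g)" using fin by (intro card_Diff_subset) (auto simp: C_def)
    finally show ?thesis .
  qed
  have Bsub: "B g \<subseteq> ?V" and finB: "finite (B g)" for g using fin by (auto simp: B_def)
  define X1 where "X1 = {g \<in> ?X. card (B g) < 3}"
  define X2 where "X2 = {g \<in> ?X. 3 \<le> card (B g)}"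
  have split: "sum ?f ?X = sum ?f X1 + sum ?f X2"
    using finX by (subst sum.union_disjoint[symmetric]) (auto simp: X1_def X2_def intro!: sum.cong)
  define nb where "nb = {w. {v, w} \<in> F}"
  have "inj_on (\<lambda>w. {v, w}) nb" by (auto simp: inj_on_def doubleton_eq_iff)
  moreover have "(\<lambda>w. {v, w}) ` nb \<subseteq> edges_at F v" by (auto simp: nb_def edges_at_def)
  moreover have "finite (edges_at F v)" using finF by (simp add: edges_at_def)
  ultimately have nb: "card nb \<le> card (edges_at F v)" by (rule card_inj_on_le)
  have finnb: "finite nb" using finW by (rule finite_subset[rotated]) (auto simp: nb_def)
  have X2_le: "sum ?f X2 \<le> (\<Sum>(U, D)\<in>overlaps H. real N ^ card U * real n ^ (card ?V - card U) *
      p ^ (card ?E - card D))"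
  proof -
    \<comment> \<open>Injectivity and \<open>B g = U\<close> are relaxed, so each class lies in a
      product set with at most \<open>N\<close> choices for a vertex in \<open>U\<close> and
      \<open>n\<close> for any other.\<close>
    define A where "A = (\<lambda>(U, D). {g \<in> Pi\<^sub>E ?V (\<lambda>z. if z \<in> U then ?W else {..<n}). C g = D})"
    have "sum ?f X2 \<le> (\<Sum>i\<in>overlaps H. (case i of (U, D) \<Rightarrow> real N ^ card U * real n ^ (card ?V - card U)) *
        (case i of (U, D) \<Rightarrow> p ^ (card ?E - card D)))"
    proof (rule sum_le_sum_cover[where A = A])
      show "X2 \<subseteq> (\<Union>i\<in>overlaps H. A i)"
      proof
        fix g assume g: "g \<in> X2"
        then have "(B g, C g) \<in> overlaps H"
          using CB Cne Bsub by (auto simp: overlaps_def X2_def C_def)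
        moreover have "g \<in> A (B g, C g)"
          using g g_embs by (auto simp: A_def embs_def B_def X2_def PiE_def Pi_def)
        ultimately show "g \<in> (\<Union>i\<in>overlaps H. A i)" by blast
      qed
      fix i assume "i \<in> overlaps H"
      then obtain U D where i: "i = (U, D)" "U \<subseteq> ?V" by (auto simp: overlaps_def)
      let ?P = "Pi\<^sub>E ?V (\<lambda>z. if z \<in> U then ?W else {..<n})"
      have finP: "finite ?P" using fin finW by (intro finite_PiE) auto
      then show "finite (A i)" by (simp add: A_def i)
      show "0 \<le> (case i of (U, D) \<Rightarrow> p ^ (card ?E - card D))" using p by (simp add: i)
      show "?f g \<le> (case i of (U, D) \<Rightarrow> p ^ (card ?E - card D))" if "g \<in> X2" "g \<in> A i" for g
        using that cardC by (simp add: i A_def X2_def)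
      have "card (A i) \<le> card ?P" using finP by (intro card_mono) (auto simp: A_def i)
      also have "card ?P = (\<Prod>z\<in>?V. if z \<in> U then card ?W else n)"
        unfolding card_PiE[OF fin(1)] by (intro prod.cong) auto
      also have "\<dots> = card ?W ^ card U * n ^ (card ?V - card U)"
        using fin i(2) by (simp add: prod.If_cases Int_absorb1 card_Diff_subset finite_subset flip: Diff_eq)
      also have "\<dots> \<le> N ^ card U * n ^ (card ?V - card U)"
        using N by (intro mult_right_mono power_mono) auto
      finally have "real (card (A i)) \<le> real (N ^ card U * n ^ (card ?V - card U))" by (simp only: of_nat_le_iff)
      then show "real (card (A i)) \<le> (case i of (U, D) \<Rightarrow> real N ^ card U * real n ^ (card ?V - card U))"
        by (simp add: i)
    qed (use p finite_overlaps[OF H] in auto)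
    then show ?thesis by (simp add: case_prod_unfold)
  qed
  have X1_le: "sum ?f X1 \<le> real (card ?V) ^ 2 * real (min_degree H) *
        (real n ^ (card ?V - 2) * p ^ (card ?E - 1))"
  proof (cases "?X = {}")
    case True
    then show ?thesis using p by (simp add: X1_def)
  next
    case False
    \<comment> \<open>The degree bound at \<open>v\<close> is part of membership in
      \<open>extensions\<close>, so it is available once some extension exists.\<close>
    then have nbd: "card nb \<le> min_degree H" using nb by (auto simp: extensions_def)
    define I where "I = {(x, y). x \<in> ?V \<and> y \<in> ?V \<and> x \<noteq> y}"
    have I: "I \<subseteq> ?V \<times> ?V" "finite (?V \<times> ?V)" using fin by (auto simp: I_def)
    define A where "A = (\<lambda>(x, y). Pi\<^sub>E ?V (\<lambda>z. if z = x then {v} else if z = y then nb else {..<n}))"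
    have "sum ?f X1 \<le> (\<Sum>i\<in>I. (real (min_degree H) * real n ^ (card ?V - 2)) * p ^ (card ?E - 1))"
    proof (rule sum_le_sum_cover[where A = A])
      show "finite I" using I finite_subset by blast
      show "X1 \<subseteq> (\<Union>i\<in>I. A i)"
      proof
        fix g assume g: "g \<in> X1"
        then obtain e where e: "e \<in> ?E" "v \<in> g ` e" "g ` e \<in> F"
          by (auto simp: X1_def extensions_def edges_at_def copy_def)
        then obtain x where x: "x \<in> e" "g x = v" by blast
        then obtain y where y: "e = {x, y}" "y \<noteq> x" "y \<in> ?V" using edge_pair[OF H e(1)] by metis
        have "x \<in> ?V" using x y simple_graph_edge_subset[OF H e(1)] by auto
        then have "(x, y) \<in> I" using y by (auto simp: I_def)
        moreover have "g \<in> ?V \<rightarrow>\<^sub>E {..<n}" using g g_embs by (auto simp: X1_def embs_def)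
        then have "g \<in> A (x, y)" using e x y by (auto simp: A_def nb_def PiE_def Pi_def)
        ultimately show "g \<in> (\<Union>i\<in>I. A i)" by blast
      qed
      show "?f g \<le> p ^ (card ?E - 1)" if "g \<in> X1" for g
      proof -
        have g: "g \<in> ?X" "card (B g) < 3" using that by (auto simp: X1_def)
        \<comment> \<open>Each shared edge is a 2-element subset of \<open>B g\<close>, which has at
          most two elements; hence there is only one such edge.\<close>
        have "e = B g" if "e \<in> C g" for e
          using CB[OF g(1)] that g(2) finB by (intro card_seteq) (auto simp: nsets_def)
        then have "C g = {B g}" using Cne[OF g(1)] by blast
        then show ?thesis using cardC[OF g(1)] by simp
      qed
      fix i assume "i \<in> I"
      then obtain x y where i: "i = (x, y)" "x \<in> ?V" "y \<in> ?V" "x \<noteq> y" by (auto simp: I_def)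
      show "finite (A i)" using fin finnb by (auto simp: A_def i intro!: finite_PiE)
      have "card (A i) = (\<Prod>z\<in>?V. card (if z = x then {v} else if z = y then nb else {..<n}))"
        unfolding A_def i prod.case card_PiE[OF fin(1)] ..
      also have "\<dots> = card nb * (\<Prod>z\<in>?V - {x} - {y}. card (if z = x then {v} else if z = y then nb else {..<n}))"
        using i fin by (simp add: prod.remove[of ?V x] prod.remove[of "?V - {x}" y])
      also have "(\<Prod>z\<in>?V - {x} - {y}. card (if z = x then {v} else if z = y then nb else {..<n})) =
          (\<Prod>z\<in>?V - {x} - {y}. n)" by (rule prod.cong) auto
      also have "\<dots> = n ^ (card ?V - 2)" using i fin by (simp add: card_Diff_singleton numeral_2_eq_2)
      finally have "card (A i) \<le> min_degree H * n ^ (card ?V - 2)" using nbd by simp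
      then have "real (card (A i)) \<le> real (min_degree H * n ^ (card ?V - 2))" by (simp only: of_nat_le_iff)
      then show "real (card (A i)) \<le> real (min_degree H) * real n ^ (card ?V - 2)" by simp
    qed (use p in auto)
    also have "\<dots> = real (card I) * (real (min_degree H) * (real n ^ (card ?V - 2) * p ^ (card ?E - 1)))"
      by simp
    also have "\<dots> \<le> real (card ?V) ^ 2 * (real (min_degree H) * (real n ^ (card ?V - 2) * p ^ (card ?E - 1)))"
    proof (rule mult_right_mono)
      have "card I \<le> card ?V ^ 2" using card_mono[OF I(2,1)] by (simp add: card_cartesian_product power2_eq_square)
      then have "real (card I) \<le> real (card ?V ^ 2)" by (simp only: of_nat_le_iff)
      then show "real (card I) \<le> real (card ?V) ^ 2" by simp
    qed (use p in auto)
    finally show ?thesis by (simp add: mult_ac)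
  qed
  show ?thesis using split X1_le X2_le by simp
qed

subsection \<open>Asymptotics\<close>

lemma m2_eq_d2:
  assumes "simple_graph H" "strictly_2_balanced H"
  shows "m2 H = d2 H"
proof -
  let ?D = "{d2 J |J. subgraph_of J H}"
  have "?D \<subseteq> (\<lambda>(V, E). d2 (Ugraph V E)) ` (Pow (verts H) \<times> Pow (edges H))"
  proof
    fix x assume "x \<in> ?D"
    then obtain J where "x = d2 J" "subgraph_of J H" by blast
    then show "x \<in> (\<lambda>(V, E). d2 (Ugraph V E)) ` (Pow (verts H) \<times> Pow (edges H))"
      by (intro rev_image_eqI[of "(verts J, edges J)"]) (auto simp: subgraph_of_def)
  qed
  then have "finite ?D"
    by (rule finite_subset) (simp add: simple_graph_finite[OF assms(1)])
  moreover have "y \<le> d2 H" if "y \<in> ?D" for y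
    using that assms(2) by (force simp: strictly_2_balanced_def)
  moreover have "d2 H \<in> ?D" using assms(1) by (auto simp: subgraph_of_def)
  ultimately show ?thesis unfolding m2_def by (rule Max_eqI)
qed

text \<open>A value above 1 rules out the default values 1/2 and 0 of \<open>d2\<close>, so the
  quotient applies. A quotient above 1 then forces a second edge.\<close>

lemma m2_gt_one_formula:
  assumes "simple_graph H" "strictly_2_balanced H" "1 < m2 H"
  shows "3 \<le> card (verts H)" "2 \<le> card (edges H)"
    "m2 H * (real (card (verts H)) - 2) = real (card (edges H)) - 1"
proof -
  have d: "1 < d2 H" "m2 H = d2 H" using assms m2_eq_d2[of H] by auto
  then have c: "1 \<le> card (edges H)" "3 \<le> card (verts H)"
    by (auto simp: d2_def split: if_splits)
  then have "d2 H = (real (card (edges H)) - 1) / (real (card (verts H)) - 2)" by (simp add: d2_def)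
  then show eq: "m2 H * (real (card (verts H)) - 2) = real (card (edges H)) - 1"
    using c d by (simp add: field_simps)
  have "1 * (real (card (verts H)) - 2) \<le> m2 H * (real (card (verts H)) - 2)"
    using c assms(3) by (intro mult_right_mono) auto
  then have "real (card (verts H)) - 2 \<le> real (card (edges H)) - 1" unfolding eq by simp
  moreover have "3 \<le> real (card (verts H))" using c by simp
  ultimately have "2 \<le> real (card (edges H))" by linarith
  then show "2 \<le> card (edges H)" by simp
  show "3 \<le> card (verts H)" by fact
qed

text \<open>For \<open>d = 0\<close> and \<open>d = 1\<close> the upper bound is 0 and 2/3, which
  leaves no room above 1.\<close>

lemma min_degree_ge_two:
  assumes "1 < m" "m < real d * (real d + 1) / (2 * real d + 1)"
  shows "2 \<le> d"
proof (rule ccontr)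
  assume "\<not> 2 \<le> d"
  then have "d = 0 \<or> d = 1" by auto
  then show False using assms by auto
qed

text \<open>A triangle has \<open>d2\<close> equal to 2. For minimum degree 2 the theorem assumes
  \<open>m2 H < 6/5\<close>, so \<open>H\<close> is then triangle-free, as the recolouring
  requires.\<close>

lemma triangle_imp_two_le_m2:
  assumes H: "simple_graph H" "strictly_2_balanced H"
    and e: "{x, y} \<in> edges H" "{y, z} \<in> edges H" "{x, z} \<in> edges H"
  shows "2 \<le> m2 H"
proof -
  have in_nsets: "{x, y} \<in> nsets (verts H) 2" "{y, z} \<in> nsets (verts H) 2" "{x, z} \<in> nsets (verts H) 2"
    using H e by (auto simp only: simple_graph_def)
  then have ne: "x \<noteq> y" "y \<noteq> z" "x \<noteq> z" "x \<in> verts H" "y \<in> verts H" "z \<in> verts H" by auto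
  define J where "J = Ugraph {x, y, z} {{x, y}, {y, z}, {x, z}}"
  have "subgraph_of J H" using e ne by (auto simp: J_def subgraph_of_def simple_graph_def)
  then have "d2 J \<le> d2 H" using H by (cases "J = H") (auto simp: strictly_2_balanced_def less_imp_le)
  moreover have "{x, y} \<noteq> {y, z}" "{x, y} \<noteq> {x, z}" "{y, z} \<noteq> {x, z}"
    using ne by (auto simp: doubleton_eq_iff)
  then have "card (edges J) = 3" "card (verts J) = 3" using ne by (auto simp: J_def)
  then have "d2 J = 2" by (simp add: d2_def)
  ultimately show ?thesis using m2_eq_d2[OF H] by simp
qed

text \<open>Strict balance gives \<open>|D| - 1 < m2 H (|U| - 2)\<close>; subtracting this from the
  formula for \<open>m2 H\<close> gives the claim. For a single edge on two vertices the exponent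
  would be exactly 0, hence the separate treatment of that overlap.\<close>

lemma overlap_exponent_neg:
  assumes H: "simple_graph H" "strictly_2_balanced H" "1 < m2 H" and UD: "(U, D) \<in> overlaps H"
  shows "real (card (verts H) - card U) - real (card (edges H) - card D) / m2 H < 0"
proof -
  have U: "U \<subseteq> verts H" "3 \<le> card U" "D \<subseteq> edges H" "D \<subseteq> nsets U 2" "D \<noteq> {}" "D \<noteq> edges H"
    using UD by (auto simp: overlaps_def)
  have fin: "finite (verts H)" "finite (edges H)" using simple_graph_finite[OF H(1)] by auto
  have cU: "card U \<le> card (verts H)" and cD: "card D \<le> card (edges H)"
    using card_mono[OF fin(1) U(1)] card_mono[OF fin(2) U(3)] by auto
  have finU: "finite U" "finite D"
    using finite_subset[OF U(1) fin(1)] finite_subset[OF U(3) fin(2)] by auto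
  then have D1: "1 \<le> card D" using U by (simp add: Suc_le_eq card_gt_0_iff)
  have "subgraph_of (Ugraph U D) H" using U finU by (simp add: subgraph_of_def simple_graph_def)
  moreover have "Ugraph U D \<noteq> H" using U by auto
  ultimately have "d2 (Ugraph U D) < m2 H"
    using H(2) m2_eq_d2[OF H(1,2)] by (simp add: strictly_2_balanced_def)
  then have "real (card D) - 1 < m2 H * (real (card U) - 2)"
    using U(2) D1 by (simp add: d2_def field_simps)
  then have "m2 H * (real (card (verts H)) - real (card U)) < real (card (edges H)) - real (card D)"
    using m2_gt_one_formula(3)[OF H] by (simp add: algebra_simps)
  then have "real (card (verts H)) - real (card U) < (real (card (edges H)) - real (card D)) / m2 H"
    using H(3) by (simp add: pos_less_divide_eq mult.commute)
  then show ?thesis using cU cD by simp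
qed

section \<open>First moment of small dense subgraphs\<close>

lemma measure_pmf_le_of_support:
  assumes "A \<inter> set_pmf M \<subseteq> B"
  shows "measure_pmf.prob M A \<le> measure_pmf.prob M B"
proof -
  have "measure_pmf.prob M (A \<inter> set_pmf M) \<le> measure_pmf.prob M B"
    using assms by (intro measure_pmf.finite_measure_mono) auto
  then show ?thesis by (simp add: measure_Int_set_pmf)
qed

text \<open>Union bound over vertex sets \<open>S\<close> of size \<open>s\<close> and sets of
  exactly \<open>\<lceil>M s\<rceil>\<close> pairs inside \<open>S\<close>, at most
  \<open>(k^2) ^ \<lceil>M s\<rceil>\<close> per \<open>S\<close>. As \<open>k^2 r \<le> 1\<close>,
  rounding the exponent down to \<open>M s\<close> only increases the bound, which becomes the
  \<open>s\<close>-th power of \<open>n (k^2 r) powr M\<close>. This base is at most 1, so each of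
  the \<open>k\<close> sizes contributes at most the base itself.\<close>

lemma prob_dense_le:
  fixes p r M :: real
  assumes p: "0 \<le> p" "p \<le> 1" "p \<le> r" and M: "0 < M" and r: "0 < r" "real k ^ 2 * r \<le> 1"
    and k: "1 \<le> k" and q: "real n * (real k ^ 2 * r) powr M \<le> 1"
  shows "measure_pmf.prob (random_graph n p) {G. \<exists>F. F \<noteq> {} \<and> F \<subseteq> edges G \<and> card (\<Union>F) \<le> k \<and>
      M * real (card (\<Union>F)) \<le> real (card F)} \<le> real k * (real n * (real k ^ 2 * r) powr M)"
    (is "measure_pmf.prob _ ?B \<le> _")
proof -
  let ?M = "measure_pmf.prob (random_graph n p)"
  define a where "a s = nat \<lceil>M * real s\<rceil>" for s
  define C where "C s S = (\<Union>D\<in>nsets (nsets S 2) (a s). {G :: nat ugraph. D \<subseteq> edges G})" for s S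
  have fin: "finite (nsets {..<n} s)" for s by (simp add: finite_imp_finite_nsets)
  have binom: "m choose l \<le> m ^ l" for m l :: nat
    by (cases "l \<le> m") (auto simp: binomial_le_pow binomial_eq_0)
  have "?B \<inter> set_pmf (random_graph n p) \<subseteq> (\<Union>s\<in>{1..k}. \<Union>S\<in>nsets {..<n} s. C s S)"
  proof
    fix G assume "G \<in> ?B \<inter> set_pmf (random_graph n p)"
    then obtain F where F: "F \<noteq> {}" "F \<subseteq> edges G" "card (\<Union>F) \<le> k"
      "M * real (card (\<Union>F)) \<le> real (card F)" and G: "edges G \<subseteq> nsets {..<n} 2"
      using set_random_graphD[of G n p] by auto
    let ?S = "\<Union>F"
    have F2: "F \<subseteq> nsets {..<n} 2" using F G by blast
    then have Sn: "?S \<subseteq> {..<n}" by (auto simp: nsets_def)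
    then have finS: "finite ?S" by (rule finite_subset) simp
    have FS: "F \<subseteq> nsets ?S 2" using F2 by (auto simp: nsets_def)
    obtain f where "f \<in> F" using F by blast
    then have "f \<noteq> {}" using F2 by (auto simp: nsets_def)
    then have "?S \<noteq> {}" using \<open>f \<in> F\<close> by blast
    then have s1: "1 \<le> card ?S" using finS by (simp add: Suc_le_eq card_gt_0_iff)
    have "a (card ?S) \<le> card F" using F(4) by (simp add: a_def nat_le_iff ceiling_le_iff)
    then obtain D where D: "D \<subseteq> F" "card D = a (card ?S)" "finite D"
      by (rule obtain_subset_with_card_n)
    then have "D \<in> nsets (nsets ?S 2) (a (card ?S))" using FS by (auto simp: nsets_def)
    then have "G \<in> C (card ?S) ?S" using D(1) F(2) by (auto simp: C_def)
    moreover have "?S \<in> nsets {..<n} (card ?S)" using Sn finS by (auto simp: nsets_def)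
    ultimately show "G \<in> (\<Union>s\<in>{1..k}. \<Union>S\<in>nsets {..<n} s. C s S)" using s1 F(3) by fastforce
  qed
  then have "?M ?B \<le> ?M (\<Union>s\<in>{1..k}. \<Union>S\<in>nsets {..<n} s. C s S)"
    by (rule measure_pmf_le_of_support)
  also have "\<dots> \<le> (\<Sum>s\<in>{1..k}. ?M (\<Union>S\<in>nsets {..<n} s. C s S))"
    by (rule measure_UNION_le) auto
  also have "\<dots> \<le> (\<Sum>s\<in>{1..k}. real n * (real k ^ 2 * r) powr M)"
  proof (rule sum_mono)
    fix s assume s: "s \<in> {1..k}"
    have CS: "?M (C s S) \<le> (real k ^ 2) ^ a s * r ^ a s" if S: "S \<in> nsets {..<n} s" for S
    proof -
      have S2: "card S = s" "S \<subseteq> {..<n}" "finite S" using S by (auto simp: nsets_def)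
      have "?M (C s S) \<le> (\<Sum>D\<in>nsets (nsets S 2) (a s). ?M {G. D \<subseteq> edges G})"
        unfolding C_def by (rule measure_UNION_le) (auto simp: finite_imp_finite_nsets S2)
      also have "\<dots> = (\<Sum>D\<in>nsets (nsets S 2) (a s). p ^ a s)"
      proof (rule sum.cong[OF refl])
        fix D assume "D \<in> nsets (nsets S 2) (a s)"
        then have "D \<subseteq> nsets {..<n} 2" "card D = a s"
          using nsets_mono[OF S2(2), of 2] by (auto simp: nsets_def)
        then show "?M {G. D \<subseteq> edges G} = p ^ a s" using prob_contains_edges p by metis
      qed
      also have "\<dots> = real ((s choose 2) choose a s) * p ^ a s" by (simp add: S2)
      also have "\<dots> \<le> (real k ^ 2) ^ a s * r ^ a s"
      proof (rule mult_mono)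
        have "s choose 2 \<le> k ^ 2" using binom[of s 2] s by (meson atLeastAtMost_iff le_trans power_mono zero_le)
        then have "(s choose 2) choose a s \<le> (k ^ 2) ^ a s"
          using binom[of "s choose 2" "a s"] power_mono le_trans by blast
        then have "real ((s choose 2) choose a s) \<le> real ((k ^ 2) ^ a s)" by (simp only: of_nat_le_iff)
        then show "real ((s choose 2) choose a s) \<le> (real k ^ 2) ^ a s" by simp
        show "p ^ a s \<le> r ^ a s" using p by (intro power_mono) auto
      qed (use p in auto)
      finally show ?thesis .
    qed
    have x: "0 < real k ^ 2 * r" using k r by simp
    have "?M (\<Union>S\<in>nsets {..<n} s. C s S) \<le> (\<Sum>S\<in>nsets {..<n} s. ?M (C s S))"
      by (rule measure_UNION_le[OF fin]) auto
    also have "\<dots> \<le> real (card (nsets {..<n} s)) * ((real k ^ 2) ^ a s * r ^ a s)"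
      by (rule sum_bounded_above) (rule CS)
    also have "\<dots> \<le> real n ^ s * (real k ^ 2 * r) powr (M * real s)"
    proof (rule mult_mono)
      have "real (n choose s) \<le> real (n ^ s)" using binom[of n s] by (simp only: of_nat_le_iff)
      then show "real (card (nsets {..<n} s)) \<le> real n ^ s" by simp
      have "(real k ^ 2) ^ a s * r ^ a s = (real k ^ 2 * r) powr real (a s)"
        using x by (simp add: powr_realpow power_mult_distrib)
      also have "\<dots> \<le> (real k ^ 2 * r) powr (M * real s)"
        using x r(2) by (intro powr_mono') (auto simp: a_def of_nat_ceiling)
      finally show "(real k ^ 2) ^ a s * r ^ a s \<le> (real k ^ 2 * r) powr (M * real s)" .
    qed (use r in auto)
    also have "\<dots> = (real n * (real k ^ 2 * r) powr M) ^ s"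
    proof -
      have "(real k ^ 2 * r) powr (M * real s) = ((real k ^ 2 * r) powr M) powr real s"
        by (simp add: powr_powr)
      also have "\<dots> = ((real k ^ 2 * r) powr M) ^ s"
        using k r by (intro powr_realpow) auto
      finally show ?thesis by (simp add: power_mult_distrib)
    qed
    also have "\<dots> \<le> (real n * (real k ^ 2 * r) powr M) ^ 1"
      using q s by (intro power_decreasing) auto
    finally show "?M (\<Union>S\<in>nsets {..<n} s. C s S) \<le> real n * (real k ^ 2 * r) powr M" by simp
  qed
  finally show ?thesis by simp
qed

section \<open>Subcriticality and the limit\<close>

text \<open>In the single-edge term the powers of \<open>n\<close> cancel exactly by the formula for
  \<open>m2 H\<close>, leaving \<open>c ^ (card (edges H) - 1)\<close>, at most \<open>c\<close>
  because \<open>H\<close> has two edges. In the other terms the powers of \<open>c\<close> are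
  bounded by 1.\<close>

lemma sum_extensions_le_decay:
  fixes p c :: real
  assumes H: "simple_graph H" "strictly_2_balanced H" "1 < m2 H" and n: "1 \<le> n" and N: "1 \<le> N"
    and c: "0 < c" "c \<le> 1" and p: "0 \<le> p" "p \<le> c * real n powr (- 1 / m2 H)"
    and F: "F \<subseteq> nsets {..<n} 2" "card (\<Union>F) \<le> N"
  shows "(\<Sum>g\<in>extensions H n v F. p ^ card (copy H g - F)) \<le>
      real (card (verts H)) ^ 2 * real (min_degree H) * c +
      (\<Sum>(U, D)\<in>overlaps H. real N ^ card (verts H) *
        real n powr (real (card (verts H) - card U) - real (card (edges H) - card D) / m2 H))"
proof -
  let ?h = "card (verts H)" and ?e = "card (edges H)" and ?m = "m2 H"
  note f = m2_gt_one_formula[OF H]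
  have fin: "finite (verts H)" using simple_graph_finite[OF H(1)] by simp
  have rpow: "(real n powr (- 1 / ?m)) ^ j = real n powr (- (real j / ?m))" for j
    using n by (simp add: powr_powr flip: powr_realpow)
  have npow: "real n ^ j = real n powr real j" for j using n by (simp add: powr_realpow)
  have ppow: "p ^ j \<le> c ^ j * real n powr (- (real j / ?m))" for j
    using power_mono[OF p(2,1), of j] unfolding power_mult_distrib rpow .
  have 1: "real n ^ (?h - 2) * p ^ (?e - 1) \<le> c"
  proof -
    have "real (?e - 1) / ?m = real (?h - 2)"
      using f H(3) by (simp add: field_simps)
    then have "real n ^ (?h - 2) * p ^ (?e - 1) \<le>
        real n powr real (?h - 2) * (c ^ (?e - 1) * real n powr (- real (?h - 2)))"
      using ppow[of "?e - 1"] by (simp add: npow mult_left_mono)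
    also have "\<dots> = c ^ (?e - 1)" using n by (simp add: powr_minus)
    also have "\<dots> \<le> c ^ 1" using c f by (intro power_decreasing) auto
    finally show ?thesis by simp
  qed
  have 2: "real N ^ card U * real n ^ (?h - card U) * p ^ (?e - card D) \<le>
      real N ^ ?h * real n powr (real (?h - card U) - real (?e - card D) / ?m)"
    if "(U, D) \<in> overlaps H" for U D
  proof -
    have "card U \<le> ?h" using that fin by (auto simp: overlaps_def intro: card_mono)
    then have NU: "real N ^ card U \<le> real N ^ ?h" using N by (intro power_increasing) auto
    have "c ^ (?e - card D) \<le> 1" using c by (simp add: power_le_one)
    then have "c ^ (?e - card D) * real n powr (- (real (?e - card D) / ?m)) \<le>
        1 * real n powr (- (real (?e - card D) / ?m))" by (intro mult_right_mono) auto
    then have "p ^ (?e - card D) \<le> real n powr (- (real (?e - card D) / ?m))"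
      using ppow[of "?e - card D"] by simp
    then have "real n ^ (?h - card U) * p ^ (?e - card D) \<le>
        real n powr real (?h - card U) * real n powr (- (real (?e - card D) / ?m))"
      unfolding npow by (intro mult_left_mono) auto
    also have "\<dots> = real n powr (real (?h - card U) - real (?e - card D) / ?m)"
      by (simp flip: powr_add)
    finally have "real N ^ card U * (real n ^ (?h - card U) * p ^ (?e - card D)) \<le>
        real N ^ ?h * real n powr (real (?h - card U) - real (?e - card D) / ?m)"
      using NU p(1) by (intro mult_mono) auto
    then show ?thesis by (simp add: mult_ac)
  qed
  have "(\<Sum>g\<in>extensions H n v F. p ^ card (copy H g - F)) \<le>
      real ?h ^ 2 * real (min_degree H) * (real n ^ (?h - 2) * p ^ (?e - 1)) +
      (\<Sum>(U, D)\<in>overlaps H. real N ^ card U * real n ^ (?h - card U) * p ^ (?e - card D))"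
    by (rule sum_extensions_le[OF H(1) p(1) F])
  also have "\<dots> \<le> real ?h ^ 2 * real (min_degree H) * c +
      (\<Sum>(U, D)\<in>overlaps H. real N ^ ?h *
        real n powr (real (?h - card U) - real (?e - card D) / ?m))"
    using 1 2 by (intro add_mono mult_left_mono sum_mono) auto
  finally show ?thesis .
qed

text \<open>Union bound over the starting copy and the dense alternative. The first copy and
  \<open>k\<close> further ones span at most \<open>card (verts H) * (k + 1)\<close> vertices, hence
  the range in which \<open>ext\<close> is assumed.\<close>

lemma prob_anti_ramsey_le:
  fixes p lam M :: real
  assumes H: "simple_graph H" "2 \<le> min_degree H" "edges H \<noteq> {}"
    "min_degree H = 2 \<Longrightarrow> \<not> (\<exists>x y z. {x, y} \<in> edges H \<and> {y, z} \<in> edges H \<and> {x, z} \<in> edges H)"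
    and p: "0 \<le> p" "p \<le> 1" and lam: "0 < lam" "lam \<le> 1"
    and ext: "\<And>v F. F \<subseteq> nsets {..<n} 2 \<Longrightarrow> card (\<Union>F) \<le> card (verts H) * (k + 1) \<Longrightarrow>
      (\<Sum>g\<in>extensions H n v F. p ^ card (copy H g - F)) \<le> lam ^ card (verts H)"
    and M: "M = real (min_degree H) * (real (min_degree H) + 1) / (2 * real (min_degree H) + 1)"
  shows "measure_pmf.prob (random_graph n p) {G. anti_ramsey G H} \<le>
     real n ^ card (verts H) * ((2 * lam) ^ k / lam ^ card (verts H)) +
     measure_pmf.prob (random_graph n p) {G. \<exists>F. F \<noteq> {} \<and> F \<subseteq> edges G \<and> card (\<Union>F) \<le> k \<and>
      M * real (card (\<Union>F)) \<le> real (card F)}"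
proof -
  let ?M = "measure_pmf.prob (random_graph n p)" and ?h = "card (verts H)"
  let ?B = "{G. \<exists>F. F \<noteq> {} \<and> F \<subseteq> edges G \<and> card (\<Union>F) \<le> k \<and> M * real (card (\<Union>F)) \<le> real (card F)}"
  define E where "E g = {G :: nat ugraph. copy H g \<subseteq> edges G \<and>
    explore H n (edges G) k (\<Union>(copy H g)) (copy H g)}" for g
  have fin: "finite (verts H)" using simple_graph_finite[OF H(1)] by simp
  have "{G. anti_ramsey G H} \<inter> set_pmf (random_graph n p) \<subseteq> (\<Union>g\<in>embs H n. E g) \<union> ?B"
  proof
    fix G assume G: "G \<in> {G. anti_ramsey G H} \<inter> set_pmf (random_graph n p)"
    then have G2: "verts G = {..<n}" "edges G \<subseteq> nsets {..<n} 2" using set_random_graphD by blast+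
    then have "anti_ramsey (Ugraph {..<n} (edges G)) H" using G by (metis IntD1 mem_Collect_eq ugraph.collapse)
    from anti_ramsey_imp_explore_or_dense[OF H G2(2) this, of k]
    show "G \<in> (\<Union>g\<in>embs H n. E g) \<union> ?B"
    proof
      assume "\<exists>F. F \<noteq> {} \<and> F \<subseteq> edges G \<and> card (\<Union>F) \<le> k \<and>
        min_degree H * (min_degree H + 1) * card (\<Union>F) \<le> (2 * min_degree H + 1) * card F"
      then obtain F where F: "F \<noteq> {}" "F \<subseteq> edges G" "card (\<Union>F) \<le> k"
        "min_degree H * (min_degree H + 1) * card (\<Union>F) \<le> (2 * min_degree H + 1) * card F" by blast
      from F(4) have "real (min_degree H * (min_degree H + 1) * card (\<Union>F)) \<le>
          real ((2 * min_degree H + 1) * card F)" by (simp only: of_nat_le_iff)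
      then have "M * real (card (\<Union>F)) \<le> real (card F)" by (simp add: M field_simps)
      then show ?thesis using F by blast
    qed (auto simp: E_def)
  qed
  then have "?M {G. anti_ramsey G H} \<le> ?M ((\<Union>g\<in>embs H n. E g) \<union> ?B)"
    by (rule measure_pmf_le_of_support)
  also have "\<dots> \<le> ?M (\<Union>g\<in>embs H n. E g) + ?M ?B" by (rule measure_Un_le) auto
  also have "?M (\<Union>g\<in>embs H n. E g) \<le> (\<Sum>g\<in>embs H n. ?M (E g))"
    by (rule measure_UNION_le[OF finite_embs[OF H(1)]]) auto
  also have "\<dots> \<le> real (card (embs H n)) * ((2 * lam) ^ k / lam ^ ?h)"
  proof (rule sum_bounded_above)
    fix g assume g: "g \<in> embs H n"
    have "\<Union>(copy H g) \<subseteq> g ` verts H" using simple_graph_edge_subset[OF H(1)] by (auto simp: copy_def)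
    then have c: "card (\<Union>(copy H g)) \<le> ?h"
      using fin by (meson card_image_le card_mono finite_imageI le_trans)
    have "?M (E g) \<le> p ^ card (copy H g) * (2 * lam) ^ k / lam ^ card (\<Union>(copy H g))"
      unfolding E_def
      by (rule prob_explore_le[OF H(1) p lam ext copy_nsets[OF H(1) g]]) (use c in auto)
    also have "\<dots> \<le> 1 * (2 * lam) ^ k / lam ^ ?h"
      using p lam c by (intro frac_le mult_right_mono power_decreasing power_le_one) auto
    finally show "?M (E g) \<le> (2 * lam) ^ k / lam ^ ?h" by simp
  qed
  also have "\<dots> \<le> real n ^ ?h * ((2 * lam) ^ k / lam ^ ?h)"
  proof (rule mult_right_mono)
    have "card (embs H n) \<le> card (verts H \<rightarrow>\<^sub>E {..<n})"
      using fin by (intro card_mono finite_PiE) (auto simp: embs_def)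
    also have "\<dots> = n ^ ?h" using fin by (simp add: card_PiE)
    finally have "real (card (embs H n)) \<le> real (n ^ ?h)" by (simp only: of_nat_le_iff)
    then show "real (card (embs H n)) \<le> real n ^ ?h" by simp
  qed (use lam in auto)
  finally show ?thesis by simp
qed

theorem theorem2p11:
  fixes H :: "'a ugraph"
  assumes "simple_graph H"
    and "strictly_2_balanced H"
    and "1 < m2 H"
    and "m2 H < real (min_degree H) * (real (min_degree H) + 1) / (2 * real (min_degree H) + 1)"
  shows "\<exists>c::real. c > 0 \<and>
    (\<forall>p :: nat \<Rightarrow> real.
       (\<forall>n. 0 \<le> p n \<and> p n \<le> 1) \<longrightarrow>
       (\<forall>n\<ge>1. p n \<le> c * real n powr (- 1 / m2 H)) \<longrightarrow>
       (\<lambda>n. measure_pmf.prob (random_graph n (p n)) {G. anti_ramsey G H}) \<longlonglongrightarrow> 0)"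
proof -
  define h where "h = card (verts H)"
  define d where "d = min_degree H"
  define m where "m = m2 H"
  define M where "M = real d * (real d + 1) / (2 * real d + 1)"
  have m: "1 < m" "m < M" using assms by (simp_all add: m_def M_def d_def)
  have d: "2 \<le> d" using min_degree_ge_two m by (simp add: M_def)
  note hm = m2_gt_one_formula[OF assms(1-3)]
  have h: "3 \<le> h" using hm by (simp add: h_def)
  have ne: "edges H \<noteq> {}" using hm(2) by auto
  have tri: "\<not> (\<exists>x y z. {x, y} \<in> edges H \<and> {y, z} \<in> edges H \<and> {x, z} \<in> edges H)"
    if "min_degree H = 2"
    using triangle_imp_two_le_m2[OF assms(1,2)] assms(4) that by force
  \<comment> \<open>Then \<open>2 * lam\<close> is \<open>exp (- (h + 1))\<close>, so
    \<open>k \<ge> ln n\<close> steps give probability at most \<open>n\<close> to the power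
    \<open>- (h + 1)\<close>, which beats the \<open>n ^ h\<close> starting copies.\<close>
  define lam :: real where "lam = exp (- (real h + 1)) / 2"
  have lam: "0 < lam" "lam \<le> 1"
  proof -
    show "0 < lam" by (simp add: lam_def)
    have "exp (- (real h + 1)) \<le> 1" by simp
    then show "lam \<le> 1" unfolding lam_def by linarith
  qed
  \<comment> \<open>The single-edge extensions may use half of the budget \<open>lam ^ h\<close>;
    the other half is left for \<open>S n\<close>.\<close>
  define c where "c = min 1 (lam ^ h / (2 * (real h ^ 2 * real d)))"
  have c: "0 < c" "c \<le> 1" "real h ^ 2 * real d * c \<le> lam ^ h / 2"
  proof -
    have *: "0 < real h ^ 2 * real d" using h d by simp
    then show "0 < c" using lam by (simp add: c_def)
    show "c \<le> 1" by (simp add: c_def)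
    have "real h ^ 2 * real d * c \<le> real h ^ 2 * real d * (lam ^ h / (2 * (real h ^ 2 * real d)))"
      using * by (intro mult_left_mono) (auto simp: c_def)
    also have "\<dots> = lam ^ h / 2" using h d by simp
    finally show "real h ^ 2 * real d * c \<le> lam ^ h / 2" .
  qed
  define k where "k n = nat \<lceil>ln (real n)\<rceil>" for n
  \<comment> \<open>A bound for \<open>k n + 1\<close> without ceilings, open to
    \<open>real_asymp\<close>. \<open>S\<close> and \<open>Q\<close> are the overlap sum and the
    bound for dense subgraphs with \<open>L\<close> in place of \<open>k\<close>.\<close>
  define L where "L n = ln (real n) + 2" for n
  define S where "S n = (\<Sum>(U, D)\<in>overlaps H. (real h * L n) ^ h *
    real n powr (real (h - card U) - real (card (edges H) - card D) / m))" for n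
  define Q where "Q n = L n powr (2 * M + 1) * real n powr (1 - M / m)" for n
  \<comment> \<open>Finitely many terms, each a power of a logarithm times a negative power of
    \<open>n\<close>.\<close>
  have "S \<longlonglongrightarrow> (\<Sum>(U, D)\<in>overlaps H. 0)"
    unfolding S_def case_prod_unfold
  proof (rule tendsto_sum)
    fix i assume "i \<in> overlaps H"
    then have "(fst i, snd i) \<in> overlaps H" by simp
    from overlap_exponent_neg[OF assms(1-3) this]
    have "real (h - card (fst i)) - real (card (edges H) - card (snd i)) / m < 0"
      unfolding h_def m_def .
    moreover have "0 < real h" using h by simp
    ultimately show "(\<lambda>n. (real h * L n) ^ h *
        real n powr (real (h - card (fst i)) - real (card (edges H) - card (snd i)) / m)) \<longlonglongrightarrow> 0"
      unfolding L_def by real_asymp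
  qed
  then have "S \<longlonglongrightarrow> 0" by simp
  moreover have "0 < lam ^ h / 2" using lam by simp
  ultimately have S_small: "\<forall>\<^sub>F n in sequentially. S n < lam ^ h / 2" by (rule order_tendstoD(2))
  \<comment> \<open>Here the assumed gap between \<open>m2 H\<close> and \<open>M\<close> makes
    dense subgraphs unlikely.\<close>
  have "1 - M / m < 0" using m by (simp add: field_simps)
  then have Q0: "Q \<longlonglongrightarrow> 0" unfolding Q_def L_def by real_asymp
  then have Q_small: "\<forall>\<^sub>F n in sequentially. Q n < 1" by (rule order_tendstoD(2)) simp
  have "- 1 / m < 0" using m by simp
  then have "(\<lambda>n. L n ^ 2 * real n powr (- 1 / m)) \<longlonglongrightarrow> 0" unfolding L_def by real_asymp
  then have r_small: "\<forall>\<^sub>F n in sequentially. L n ^ 2 * real n powr (- 1 / m) < 1"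
    by (rule order_tendstoD(2)) simp
  show ?thesis
  proof (intro exI[of _ c] conjI allI impI)
    fix p :: "nat \<Rightarrow> real"
    assume p: "\<forall>n. 0 \<le> p n \<and> p n \<le> 1" "\<forall>n\<ge>1. p n \<le> c * real n powr (- 1 / m2 H)"
    let ?P = "\<lambda>n. measure_pmf.prob (random_graph n (p n)) {G. anti_ramsey G H}"
    have "\<forall>\<^sub>F n in sequentially. ?P n \<le> 1 / real n / lam ^ h + Q n"
      using S_small Q_small r_small eventually_ge_at_top[of 3]
    proof eventually_elim
      case (elim n)
      have n: "1 \<le> n" using elim by simp
      \<comment> \<open>From \<open>n \<ge> 3 > e\<close>; it gives \<open>1 \<le> k n\<close>, as
        the bound for dense subgraphs requires.\<close>
      have lnn: "1 \<le> ln (real n)"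
        using elim exp_le by (subst ln_ge_iff) auto
      have k: "1 \<le> k n" "ln (real n) \<le> real (k n)" "real (k n) + 1 \<le> L n"
        using lnn unfolding k_def L_def by linarith+
      let ?r = "real n powr (- 1 / m)"
      have r: "0 < ?r" using n by simp
      have kr: "real (k n) ^ 2 * ?r \<le> L n ^ 2 * ?r"
        using k by (intro mult_right_mono power_mono) auto
      have "(real (k n) ^ 2 * ?r) powr M \<le> (L n ^ 2 * ?r) powr M"
        using kr m by (intro powr_mono2) auto
      then have le: "real n * (real (k n) ^ 2 * ?r) powr M \<le> real n * (L n ^ 2 * ?r) powr M"
        by (rule mult_left_mono) simp
      have "real (k n) * (real n * (real (k n) ^ 2 * ?r) powr M) \<le> L n * (real n * (L n ^ 2 * ?r) powr M)"
        by (rule mult_mono[OF _ le]) (use k in auto)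
      also have "\<dots> = Q n"
      proof -
        have "(L n ^ 2 * ?r) powr M = L n powr (2 * M) * real n powr (- (M / m))"
          using k n by (simp add: powr_mult powr_powr flip: powr_numeral)
        moreover have "L n * L n powr (2 * M) = L n powr (2 * M + 1)"
          using k by (simp add: powr_add)
        moreover have "real n * real n powr (- (M / m)) = real n powr (1 - M / m)"
          using n by (simp add: powr_diff powr_minus divide_inverse)
        ultimately show ?thesis unfolding Q_def by (metis mult.assoc mult.left_commute)
      qed
      finally have kQ: "real (k n) * (real n * (real (k n) ^ 2 * ?r) powr M) \<le> Q n" .
      have "1 * (real n * (real (k n) ^ 2 * ?r) powr M) \<le>
          real (k n) * (real n * (real (k n) ^ 2 * ?r) powr M)"
        using k by (intro mult_right_mono) auto
      then have q1: "real n * (real (k n) ^ 2 * ?r) powr M \<le> 1" using kQ elim by linarith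
      have "p n \<le> c * ?r" using p(2) n by (simp add: m_def)
      also have "\<dots> \<le> 1 * ?r" using c r by (intro mult_right_mono) auto
      finally have pr: "p n \<le> ?r" by simp
      have "?P n \<le> real n ^ card (verts H) * ((2 * lam) ^ k n / lam ^ card (verts H)) +
         measure_pmf.prob (random_graph n (p n)) {G. \<exists>F. F \<noteq> {} \<and> F \<subseteq> edges G \<and>
          card (\<Union>F) \<le> k n \<and> M * real (card (\<Union>F)) \<le> real (card F)}"
      proof (rule prob_anti_ramsey_le[OF assms(1) _ ne tri])
        show "M = real (min_degree H) * (real (min_degree H) + 1) / (2 * real (min_degree H) + 1)"
          by (simp add: M_def d_def)
        fix v F assume F: "F \<subseteq> nsets {..<n} 2" "card (\<Union>F) \<le> card (verts H) * (k n + 1)"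
        let ?N = "card (verts H) * (k n + 1)"
        have "(\<Sum>g\<in>extensions H n v F. p n ^ card (copy H g - F)) \<le>
            real (card (verts H)) ^ 2 * real (min_degree H) * c +
            (\<Sum>(U, D)\<in>overlaps H. real ?N ^ card (verts H) *
              real n powr (real (card (verts H) - card U) - real (card (edges H) - card D) / m2 H))"
          by (rule sum_extensions_le_decay[OF assms(1-3) n _ c(1,2) _ _ F]) (use p n h in \<open>auto simp: h_def\<close>)
        also have "\<dots> \<le> lam ^ h / 2 + S n"
        proof (rule add_mono)
          show "real (card (verts H)) ^ 2 * real (min_degree H) * c \<le> lam ^ h / 2"
            using c by (simp add: h_def d_def)
          have "real ?N = real h * (real (k n) + 1)" by (simp add: h_def algebra_simps)
          also have "\<dots> \<le> real h * L n" using k(3) by (rule mult_left_mono) simp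
          finally have "real ?N ^ h \<le> (real h * L n) ^ h" by (intro power_mono) auto
          then show "(\<Sum>(U, D)\<in>overlaps H. real ?N ^ card (verts H) *
              real n powr (real (card (verts H) - card U) - real (card (edges H) - card D) / m2 H)) \<le> S n"
            unfolding S_def by (intro sum_mono) (auto simp: h_def m_def intro!: mult_right_mono)
        qed
        also have "\<dots> \<le> lam ^ h" using elim by simp
        finally show "(\<Sum>g\<in>extensions H n v F. p n ^ card (copy H g - F)) \<le> lam ^ card (verts H)"
          by (simp add: h_def)
      qed (use p lam d in \<open>auto simp: d_def\<close>)
      also have "\<dots> \<le> 1 / real n / lam ^ h + Q n"
      proof (rule add_mono)
        have "(2 * lam) ^ k n = exp (- ((real h + 1) * real (k n)))"
          by (simp add: lam_def algebra_simps flip: exp_of_nat_mult)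
        also have "\<dots> \<le> exp (- ((real h + 1) * ln (real n)))"
          using k by (simp add: mult_left_mono)
        also have "\<dots> = real n powr (- real (Suc h))" using n by (simp add: powr_def algebra_simps)
        also have "\<dots> = inverse (real n ^ Suc h)" using n by (simp only: powr_minus powr_realpow of_nat_0_less_iff)
        finally have "real n ^ h * (2 * lam) ^ k n \<le> real n ^ h * inverse (real n ^ Suc h)"
          by (intro mult_left_mono) auto
        also have "\<dots> = 1 / real n" using n by (simp add: field_simps)
        finally have "real n ^ h * (2 * lam) ^ k n / lam ^ h \<le> 1 / real n / lam ^ h"
          by (rule divide_right_mono) (use lam in simp)
        then show "real n ^ card (verts H) * ((2 * lam) ^ k n / lam ^ card (verts H)) \<le> 1 / real n / lam ^ h"
          by (simp only: h_def times_divide_eq_right)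
        show "measure_pmf.prob (random_graph n (p n)) {G. \<exists>F. F \<noteq> {} \<and> F \<subseteq> edges G \<and>
            card (\<Union>F) \<le> k n \<and> M * real (card (\<Union>F)) \<le> real (card F)} \<le> Q n"
        proof (rule order_trans[OF prob_dense_le[OF _ _ pr _ r _ k(1) q1] kQ])
          show "real (k n) ^ 2 * ?r \<le> 1" using kr elim by linarith
        qed (use p m in auto)
      qed
      finally show ?case .
    qed
    moreover have "(\<lambda>n. 1 / real n / lam ^ h + Q n) \<longlonglongrightarrow> 0 / lam ^ h + 0"
      by (rule tendsto_add[OF tendsto_divide[OF lim_1_over_n tendsto_const] Q0]) (use lam in simp)
    then have "(\<lambda>n. 1 / real n / lam ^ h + Q n) \<longlonglongrightarrow> 0" by simp
    ultimately show "?P \<longlonglongrightarrow> 0"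
      by (rule tendsto_sandwich[OF _ _ tendsto_const, rotated]) simp
  qed (rule c)
qed

end
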